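(* Let $s\in\mathbb{C}$ with $\Re s>1$, let $a\in\mathbb{R}\setminus\{0\}$, $b\in\mathbb{R}$ and $d>0$. Set $$R_{a,b,d}(s)=s\left(\int_1^{\frac{1-\{b\}}{a}}-\int_1^d\right)\lfloor ax+\{b\}\rfloor x^{-s-1}\,dx.$$ Then $$\frac{\pi}{s}\begin{cases}a^s\zeta(s,1-\{b\})-\Big(\frac{ads}{s-1}+\{b\}-\frac12\Big)d^{-s}+R_{a,b,d}(s),&\text{if }a>0\\[1mm]-(-a)^s\zeta(s,1-\{-b\})+\Big(\frac{ads}{1-s}+\{-b\}-\frac12\Big)d^{-s}-R_{-a,-b,d}(s),&\text{if }a<0\end{cases}$$ $$=\sum_{k=1}^\infty\Bigg[\frac{\sin(2\pi bk)}{d^ssk}\,{}_1F_2\Big(-\tfrac s2;\tfrac12,1-\tfrac s2;-\pi^2a^2d^2k^2\Big)-\frac{2\pi ad^{1-s}\cos(2\pi bk)}{1-s}\,{}_1F_2\Big(\tfrac12(1-s);\tfrac32,1+\tfrac12(1-s);-\pi^2a^2d^2k^2\Big)$$ $$\qquad+k^{s-1}(2\pi)^s\Gamma(-s)\frac1{2i}\Big((-ia)^se^{2\pi ibk}-(ia)^se^{-2\pi ibk}\Big)\Bigg],$$ where the series on the right-hand side converges to a holomorphic function in $s\in\mathbb{C}$. The convergence is absolute and uniform in $b$, in $a,d$ bounded away from $0$ and $\infty$, and, for every $\epsilon>0$, in $s$ with $\Re s>-\epsilon$ and $|\Im s|<\epsilon$. If $\Re s<1$ and $b\in\mathbb{R}\setminus\mathbb{Z}$,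 or $\Re s<0$ and $b\in\mathbb{Z}$, then $$\sum_{k=1}^\infty\left[\frac{2\pi a\cos(2\pi bk)}{1-s}\,{}_1F_2\Big(\tfrac12(1-s);\tfrac32,1+\tfrac12(1-s);-\pi^2a^2k^2\Big)-\frac{\sin(2\pi bk)}{sk}\,{}_1F_2\Big(-\tfrac s2;\tfrac12,1-\tfrac s2;-\pi^2a^2k^2\Big)\right]$$ $$=\frac{\pi}{s}\left(\frac{as}{s-1}+b-\frac12+R_{a,b,1}(s)\right).$$
   Context: For real $x$, $\{x\}$ is the fractional part and $\lfloor x\rfloor=x-\{x\}$ the integer part. $\zeta(s,x)=\sum_{k\ge0}(k+x)^{-s}$ ($\Re s>1$, $x>0$) is the Hurwitz zeta function. Complex powers are $u^v=e^{v\log u}$ with the principal logarithm (imaginary part in $(-\pi,\pi]$). ${}_1F_2(\alpha;\beta,\gamma;z)=\sum_{n\ge0}\frac{(\alpha)_n}{(\beta)_n(\gamma)_n}\frac{z^n}{n!}$, where $(x)_n=\Gamma(x+n)/\Gamma(x)$ is the Pochhammer symbol. Integrals are oriented.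
   Formalization: In the second formula b−1/2 becomes {b}−1/2, the sign of R_{a,b,1}(s) becomes minus, and s≠0 is required; for d<1 uniform convergence is claimed only for Re s ≤ M with M arbitrary; at s=0,1,2,… the bracket is continued holomorphically. *)

theory Defs
  imports "HOL-Complex_Analysis.Complex_Analysis"
begin

text \<open>Complex powers are written \<open>powr\<close>, which uses the principal logarithm \<open>Ln\<close> with
  imaginary part in \<open>(-pi, pi]\<close>.\<close>

definition hurwitz_zeta :: "complex \<Rightarrow> real \<Rightarrow> complex" where
  "hurwitz_zeta s x = (\<Sum>k. of_real (real k + x) powr (- s))"

definition hypergeom_1F2 :: "complex \<Rightarrow> complex \<Rightarrow> complex \<Rightarrow> complex \<Rightarrow> complex" where
  "hypergeom_1F2 \<alpha> \<beta> \<gamma> z =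
     (\<Sum>n. pochhammer \<alpha> n / (pochhammer \<beta> n * pochhammer \<gamma> n) * (z ^ n / fact n))"

text \<open>The integrals are oriented. If \<open>a < 0\<close>, the first one runs from \<open>1\<close> to a negative number;
  the integer part vanishes almost everywhere on the negative part of that range.\<close>

definition R :: "real \<Rightarrow> real \<Rightarrow> real \<Rightarrow> complex \<Rightarrow> complex" where
  "R a b d s = s *
     ((CLBINT x=ereal 1..ereal ((1 - frac b) / a).
         of_int \<lfloor>a * x + frac b\<rfloor> * of_real x powr (- s - 1)) -
      (CLBINT x=ereal 1..ereal d.
         of_int \<lfloor>a * x + frac b\<rfloor> * of_real x powr (- s - 1)))"

definition raw_term :: "real \<Rightarrow> real \<Rightarrow> real \<Rightarrow> nat \<Rightarrow> complex \<Rightarrow> complex" where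
  "raw_term a b d k s =
     of_real (sin (2 * pi * b * real k)) / (of_real d powr s * s * of_nat k) *
       hypergeom_1F2 (- s / 2) (1 / 2) (1 - s / 2) (of_real (- (pi\<^sup>2 * a\<^sup>2 * d\<^sup>2 * (real k)\<^sup>2))) -
     2 * of_real pi * of_real a * of_real d powr (1 - s) * of_real (cos (2 * pi * b * real k)) / (1 - s) *
       hypergeom_1F2 ((1 - s) / 2) (3 / 2) (1 + (1 - s) / 2)
         (of_real (- (pi\<^sup>2 * a\<^sup>2 * d\<^sup>2 * (real k)\<^sup>2))) +
     of_nat k powr (s - 1) * of_real (2 * pi) powr s * Gamma (- s) * (1 / (2 * \<i>)) *
       ((- \<i> * of_real a) powr s * exp (2 * of_real pi * \<i> * of_real b * of_nat k) -
        (\<i> * of_real a) powr s * exp (- 2 * of_real pi * \<i> * of_real b * of_nat k))"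

text \<open>For \<open>s\<close> in \<open>{0, 1, 2, ...}\<close> the individual parts of \<open>raw_term\<close> have poles (and HOL assigns
  them junk values), but the singularities of the whole term are removable. The series is
  therefore formed from the terms with these singularities removed.\<close>

definition series_term :: "real \<Rightarrow> real \<Rightarrow> real \<Rightarrow> nat \<Rightarrow> complex \<Rightarrow> complex" where
  "series_term a b d k = remove_sings (raw_term a b d k)"

text \<open>The parameter region \<open>c \<le> |a| \<le> C\<close>, \<open>c \<le> d \<le> C\<close>, \<open>Re s > -\<epsilon>\<close>, \<open>|Im s| < \<epsilon>\<close>, with \<open>b\<close>
  unrestricted. For \<open>d < 1\<close> the bound \<open>Re s \<le> M\<close> is necessary: each term is in general of
  order \<open>d powr (- Re s) / Re s\<close> as \<open>Re s\<close> tends to infinity, hence unbounded, so convergence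
  cannot be uniform there.\<close>

definition conv_region :: "real \<Rightarrow> real \<Rightarrow> real \<Rightarrow> real \<Rightarrow> (real \<times> real \<times> real \<times> complex) set" where
  "conv_region c C \<epsilon> M = {(a, b, d, s).
     c \<le> \<bar>a\<bar> \<and> \<bar>a\<bar> \<le> C \<and> c \<le> d \<and> d \<le> C \<and> Re s > - \<epsilon> \<and> \<bar>Im s\<bar> < \<epsilon> \<and> (d \<ge> 1 \<or> Re s \<le> M)}"

end

theory Submission
  imports Defs "HOL-Real_Asymp.Real_Asymp"
begin

text \<open>
  Both series are the Fourier series of the sawtooth function, integrated term by term.

  Put \<open>w = 2 * pi * k * a\<close>. Where the integrals converge, the last part of \<open>raw_term\<close>, the one with the
  gamma function, is \<open>1 / k\<close> times the integral of \<open>sin (2 * pi * k * (a * x + b)) * x powr (- s - 1)\<close>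
  over \<open>(0, \<infinity>)\<close>, while the two hypergeometric parts are minus the same integral over \<open>(0, d)\<close>. So the
  \<open>k\<close>-th term is
  \<open>1 / k\<close> times the integral over \<open>(d, \<infinity>)\<close>, and as a function of \<open>s\<close> this is entire. In terms of exponentials
  it is a combination of values of the upper incomplete gamma function on the imaginary axis
  (\<open>raw_term_conv_osc_tail\<close>). On that axis the function is controlled by moving to the right along a
  horizontal line, where its derivative decays exponentially (\<open>upper_inc_gamma_imaginary_bound\<close>). The
  resulting bound of size \<open>1 / k\<^sup>2\<close>, uniform in the parameters, does everything at once: the singularities at
  \<open>s = 0, 1, 2, ...\<close> are removable because the term stays bounded there, the series
  converges absolutely and uniformly on \<open>conv_region\<close>, its sum is entire, and the sum tends to \<open>0\<close> as
  \<open>d\<close> tends to infinity.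

  To evaluate the sum, compare two values of \<open>d\<close>. The difference of the \<open>k\<close>-th terms is an integral over
  the compact interval between them. The sine series sums boundedly to
  \<open>pi * (1 / 2 - frac (a * x + b))\<close> (\<open>sawtooth_sum_tendsto\<close>, \<open>abs_sawtooth_sum_le\<close>), so by dominated
  convergence the difference of the two sums is the integral of this function against
  \<open>x powr (- s - 1)\<close> (\<open>series_diff_has_integral\<close>). It consists of two elementary integrals and the integral of an
  integer part, which is a step function and produces the partial sums of the Hurwitz zeta function. Letting the upper end tend to
  infinity gives the formula for \<open>a > 0\<close> (\<open>series_term_sums_pos\<close>); the case \<open>a < 0\<close> follows because
  the terms are odd in \<open>(a, b)\<close>.

  The second series is the same argument on \<open>(0, 1)\<close>, where the singularity of \<open>x powr (- s - 1)\<close> at \<open>0\<close> has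
  to be compensated. For \<open>b\<close> outside the integers the partial sums of the sine series are
  Lipschitz continuous at \<open>b\<close>, uniformly in their length, because the Dirichlet kernel is
  bounded away from the integers (\<open>sawtooth_sum_lipschitz\<close>). After subtraction of the value at \<open>b\<close> the
  integrand is therefore dominated by a multiple of \<open>x powr (- Re s)\<close>, which is integrable for \<open>Re s < 1\<close>. For
  integer \<open>b\<close> the value at \<open>b\<close> is \<open>0\<close>, boundedness is all that remains, and \<open>Re s < 0\<close> is what makes
  \<open>x powr (- Re s - 1)\<close> integrable.
\<close>
section \<open>Incomplete gamma functions\<close>

text \<open>The lower incomplete gamma function divided by \<open>z powr \<alpha>\<close>. This quotient is entire
  in \<open>z\<close>, unlike the lower incomplete gamma function itself, and it equals \<open>Gamma \<alpha>\<close> times Tricomi's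
  entire function.\<close>

definition lower_gamma_ser :: "complex \<Rightarrow> complex \<Rightarrow> complex" where
  "lower_gamma_ser \<alpha> z = (\<Sum>n. (- z) ^ n / (fact n * (\<alpha> + of_nat n)))"

definition upper_inc_gamma :: "complex \<Rightarrow> complex \<Rightarrow> complex" where
  "upper_inc_gamma \<alpha> z = Gamma \<alpha> - z powr \<alpha> * lower_gamma_ser \<alpha> z"

lemma not_nonpos_Int_add_nat:
  assumes "\<alpha> \<notin> \<int>\<^sub>\<le>\<^sub>0" shows "\<alpha> + of_nat n \<noteq> (0::complex)"
  using assms by (metis add_eq_0_iff2 minus_of_nat_in_nonpos_Ints)

lemma nonpos_Ints_dist_lower_bound:
  assumes "compact K" "K \<inter> \<int>\<^sub>\<le>\<^sub>0 = {}"
  obtains \<delta> where "\<delta> > 0" "\<And>\<alpha> n. \<alpha> \<in> K \<Longrightarrow> \<delta> \<le> norm (\<alpha> + of_nat n :: complex)"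
proof -
  have "closed (\<int>\<^sub>\<le>\<^sub>0 :: complex set)"
    by (rule closed_nonpos_Ints)
  from separate_compact_closed[OF assms(1) this assms(2)]
  obtain d where d: "d > 0" "\<And>x y. x \<in> K \<Longrightarrow> y \<in> \<int>\<^sub>\<le>\<^sub>0 \<Longrightarrow> d \<le> dist x y" by blast
  have "d \<le> norm (\<alpha> + of_nat n)" if "\<alpha> \<in> K" for \<alpha> n
    using d(2)[OF that, of "- of_nat n"] by (simp add: dist_norm)
  with d(1) show ?thesis using that by blast
qed

lemma summable_exp_majorant: "summable (\<lambda>n. norm (z :: complex) ^ n / fact n / \<delta>)"
  using summable_exp_generic[of "norm z"]
  by (intro summable_divide) (simp add: scaleR_conv_of_real field_simps)

lemma norm_lower_gamma_ser_term_le: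
  fixes \<alpha> z :: complex
  assumes "\<delta> > 0" "\<delta> \<le> norm (\<alpha> + of_nat n)"
  shows "norm ((- z) ^ n / (fact n * (\<alpha> + of_nat n))) \<le> norm z ^ n / fact n / \<delta>"
  using assms
  by (auto simp: norm_divide norm_mult norm_power divide_simps intro!: mult_left_mono mult_right_mono)

lemma lower_gamma_ser_summable_norm:
  fixes \<alpha> :: complex
  assumes "\<alpha> \<notin> \<int>\<^sub>\<le>\<^sub>0"
  shows "summable (\<lambda>n. norm ((- z) ^ n / (fact n * (\<alpha> + of_nat n))))"
proof -
  obtain \<delta> where "\<delta> > 0" "\<And>\<alpha>' n. \<alpha>' \<in> {\<alpha>} \<Longrightarrow> \<delta> \<le> norm (\<alpha>' + of_nat n)"
    using nonpos_Ints_dist_lower_bound[of "{\<alpha>}"] assms by auto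
  hence "norm (norm ((- z) ^ n / (fact n * (\<alpha> + of_nat n)))) \<le> norm z ^ n / fact n / \<delta>" for n
    using norm_lower_gamma_ser_term_le[of \<delta> \<alpha> n z] by simp
  thus ?thesis by (intro summable_comparison_test'[OF summable_exp_majorant, where N = 0])
qed

lemma lower_gamma_ser_sums:
  assumes "\<alpha> \<notin> \<int>\<^sub>\<le>\<^sub>0"
  shows "(\<lambda>n. (- z) ^ n / (fact n * (\<alpha> + of_nat n))) sums lower_gamma_ser \<alpha> z"
  unfolding lower_gamma_ser_def
  by (rule summable_sums[OF summable_norm_cancel[OF lower_gamma_ser_summable_norm[OF assms]]])

text \<open>The \<open>n\<close>-th coefficients on the left combine because
  \<open>\<alpha> / (\<alpha> + n) + n / (\<alpha> + n) = 1\<close>. Together with the next lemma, which expresses the derivative through the same shifted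
  series, this is both the recurrence and the differential equation of the lower incomplete gamma function.\<close>

lemma lower_gamma_ser_recurrence:
  assumes "\<alpha> \<notin> \<int>\<^sub>\<le>\<^sub>0"
  shows "\<alpha> * lower_gamma_ser \<alpha> z - z * lower_gamma_ser (\<alpha> + 1) z = exp (- z)"
proof -
  have a1: "\<alpha> + 1 \<notin> \<int>\<^sub>\<le>\<^sub>0" using assms by (metis plus_one_in_nonpos_Ints_imp)
  have nz: "\<alpha> + of_nat n \<noteq> 0" for n using not_nonpos_Int_add_nat[OF assms] .
  have "(\<lambda>n. (- z) * ((- z) ^ n / (fact n * (\<alpha> + 1 + of_nat n)))) sums (- z * lower_gamma_ser (\<alpha> + 1) z)"
    by (intro sums_mult lower_gamma_ser_sums a1)
  also have "(\<lambda>n. (- z) * ((- z) ^ n / (fact n * (\<alpha> + 1 + of_nat n)))) =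
        (\<lambda>n. of_nat (Suc n) * (- z) ^ Suc n / (fact (Suc n) * (\<alpha> + of_nat (Suc n))))"
  proof
    fix n
    have *: "\<alpha> + of_nat (Suc n) = \<alpha> + 1 + of_nat n" by simp
    have "of_nat (Suc n) * (- z) ^ Suc n / (fact (Suc n) * (\<alpha> + of_nat (Suc n)))
       = (of_nat (Suc n) * (- z) ^ Suc n) / (of_nat (Suc n) * (fact n * (\<alpha> + 1 + of_nat n)))"
      unfolding * fact_Suc by (simp only: mult.assoc)
    also have "\<dots> = (- z) ^ Suc n / (fact n * (\<alpha> + 1 + of_nat n))"
      by (rule mult_divide_mult_cancel_left) (simp only: of_nat_eq_0_iff)
    finally show "(- z) * ((- z) ^ n / (fact n * (\<alpha> + 1 + of_nat n))) =
        of_nat (Suc n) * (- z) ^ Suc n / (fact (Suc n) * (\<alpha> + of_nat (Suc n)))" by simp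
  qed
  finally have "(\<lambda>n. of_nat n * (- z) ^ n / (fact n * (\<alpha> + of_nat n))) sums (- z * lower_gamma_ser (\<alpha> + 1) z)"
    by (subst (asm) sums_Suc_iff) auto
  from sums_add[OF sums_mult[OF lower_gamma_ser_sums[OF assms], of \<alpha> z] this]
  have "(\<lambda>n. \<alpha> * ((- z) ^ n / (fact n * (\<alpha> + of_nat n))) + of_nat n * (- z) ^ n / (fact n * (\<alpha> + of_nat n)))
          sums (\<alpha> * lower_gamma_ser \<alpha> z - z * lower_gamma_ser (\<alpha> + 1) z)" by simp
  also have "(\<lambda>n. \<alpha> * ((- z) ^ n / (fact n * (\<alpha> + of_nat n))) + of_nat n * (- z) ^ n / (fact n * (\<alpha> + of_nat n)))
     = (\<lambda>n. (- z) ^ n /\<^sub>R fact n)"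
  proof
    fix n
    have "\<alpha> * ((- z) ^ n / (fact n * (\<alpha> + of_nat n))) + of_nat n * (- z) ^ n / (fact n * (\<alpha> + of_nat n))
       = (\<alpha> + of_nat n) * (- z) ^ n / (fact n * (\<alpha> + of_nat n))"
      by (simp add: add_divide_distrib ring_distribs)
    also have "\<dots> = (- z) ^ n / fact n" using nz[of n] by simp
    finally show "\<alpha> * ((- z) ^ n / (fact n * (\<alpha> + of_nat n))) + of_nat n * (- z) ^ n / (fact n * (\<alpha> + of_nat n)) = (- z) ^ n /\<^sub>R fact n"
      by (simp add: scaleR_conv_of_real field_simps)
  qed
  finally show ?thesis using exp_converges[of "- z"] sums_unique2 by blast
qed

lemma lower_gamma_ser_has_field_derivative:
  assumes "\<alpha> \<notin> \<int>\<^sub>\<le>\<^sub>0"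
  shows "(lower_gamma_ser \<alpha> has_field_derivative - lower_gamma_ser (\<alpha> + 1) z) (at z)"
proof -
  let ?c = "\<lambda>n. (- 1) ^ n / (fact n * (\<alpha> + of_nat n))"
  have a1: "\<alpha> + 1 \<notin> \<int>\<^sub>\<le>\<^sub>0" using assms by (metis plus_one_in_nonpos_Ints_imp)
  have eq: "?c n * y ^ n = (- y) ^ n / (fact n * (\<alpha> + of_nat n))" for n y
    by (simp add: power_minus[of y])
  have "((\<lambda>y. \<Sum>n. ?c n * y ^ n) has_field_derivative (\<Sum>n. diffs ?c n * z ^ n)) (at z)"
    by (rule termdiffs_strong_converges_everywhere)
       (unfold eq, rule sums_summable[OF lower_gamma_ser_sums[OF assms]])
  also have "(\<lambda>y. \<Sum>n. ?c n * y ^ n) = lower_gamma_ser \<alpha>"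
    unfolding lower_gamma_ser_def eq ..
  also have "diffs ?c n * z ^ n = - ((- z) ^ n / (fact n * (\<alpha> + 1 + of_nat n)))" for n
  proof -
    have *: "\<alpha> + of_nat (Suc n) = \<alpha> + 1 + of_nat n" by simp
    have "diffs ?c n = (of_nat (Suc n) * (- 1) ^ Suc n) / (of_nat (Suc n) * (fact n * (\<alpha> + 1 + of_nat n)))"
      unfolding * fact_Suc diffs_def by (simp only: mult.assoc times_divide_eq_right)
    also have "\<dots> = (- 1) ^ Suc n / (fact n * (\<alpha> + 1 + of_nat n))"
      by (rule mult_divide_mult_cancel_left) (simp only: of_nat_eq_0_iff)
    finally show ?thesis by (simp add: power_minus[of z])
  qed
  hence "(\<Sum>n. diffs ?c n * z ^ n) = - lower_gamma_ser (\<alpha> + 1) z"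
    using sums_minus[OF lower_gamma_ser_sums[OF a1, of z]] by (simp add: sums_iff)
  finally show ?thesis .
qed

text \<open>The parameter \<open>p\<close> makes this one formula serve for real decay (\<open>p = 1\<close>, in the evaluation of the
  gamma integral) and for oscillation (\<open>p\<close> imaginary, in the terms of the two series).\<close>

lemma lower_inc_gamma_has_field_derivative:
  assumes "\<alpha> \<notin> \<int>\<^sub>\<le>\<^sub>0" "z \<notin> \<real>\<^sub>\<le>\<^sub>0"
  shows "((\<lambda>z. z powr \<alpha> * lower_gamma_ser \<alpha> (p * z)) has_field_derivative
           z powr (\<alpha> - 1) * exp (- (p * z))) (at z)"
proof -
  have z: "z \<noteq> 0" using assms(2) by auto
  have "((\<lambda>z. z powr \<alpha> * lower_gamma_ser \<alpha> (p * z)) has_field_derivative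
     (\<alpha> * z powr (\<alpha> - 1)) * lower_gamma_ser \<alpha> (p * z)
       + (- lower_gamma_ser (\<alpha> + 1) (p * z) * p) * z powr \<alpha>) (at z)"
    by (intro DERIV_mult has_field_derivative_powr assms
          DERIV_chain'[OF DERIV_cmult_Id lower_gamma_ser_has_field_derivative])
  also have "(\<alpha> * z powr (\<alpha> - 1)) * lower_gamma_ser \<alpha> (p * z)
       + (- lower_gamma_ser (\<alpha> + 1) (p * z) * p) * z powr \<alpha> =
      z powr (\<alpha> - 1) * (\<alpha> * lower_gamma_ser \<alpha> (p * z) - p * z * lower_gamma_ser (\<alpha> + 1) (p * z))"
    using z by (simp add: powr_diff algebra_simps)
  also have "\<dots> = z powr (\<alpha> - 1) * exp (- (p * z))"
    by (subst lower_gamma_ser_recurrence[OF assms(1)]) simp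
  finally show ?thesis .
qed

lemma lower_inc_gamma_has_vector_derivative:
  assumes "\<alpha> \<notin> \<int>\<^sub>\<le>\<^sub>0" "x > (0::real)"
  shows "((\<lambda>x. of_real x powr \<alpha> * lower_gamma_ser \<alpha> (p * of_real x)) has_vector_derivative
           of_real x powr (\<alpha> - 1) * exp (- (p * of_real x))) (at x within S)"
  using assms lower_inc_gamma_has_field_derivative[of \<alpha> "of_real x" p]
  by (intro has_vector_derivative_real_field) auto

lemma lower_gamma_ser_0: assumes "\<alpha> \<notin> \<int>\<^sub>\<le>\<^sub>0" shows "lower_gamma_ser \<alpha> 0 = 1 / \<alpha>"
proof -
  have "\<alpha> \<noteq> 0" using assms by auto
  thus ?thesis using lower_gamma_ser_recurrence[OF assms, of 0] by (simp add: field_simps)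
qed

lemma continuous_on_lower_gamma_ser [continuous_intros]:
  assumes "\<alpha> \<notin> \<int>\<^sub>\<le>\<^sub>0" "continuous_on S f"
  shows "continuous_on S (\<lambda>x. lower_gamma_ser \<alpha> (f x))"
proof (rule continuous_on_compose2[OF _ assms(2) subset_UNIV])
  show "continuous_on UNIV (lower_gamma_ser \<alpha>)"
    using lower_gamma_ser_has_field_derivative[OF assms(1)] by (rule DERIV_continuous_on)
qed

lemma holomorphic_on_lower_gamma_ser:
  "(\<lambda>\<alpha>. lower_gamma_ser \<alpha> z) holomorphic_on (- \<int>\<^sub>\<le>\<^sub>0)"
proof (rule holomorphic_uniform_sequence)
  show "open (- \<int>\<^sub>\<le>\<^sub>0 :: complex set)" by (simp add: closed_nonpos_Ints open_Compl)
  fix N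
  show "(\<lambda>\<alpha>. \<Sum>n<N. (- z) ^ n / (fact n * (\<alpha> + of_nat n))) holomorphic_on (- \<int>\<^sub>\<le>\<^sub>0)"
    using not_nonpos_Int_add_nat by (intro holomorphic_intros) auto
next
  fix x assume x: "x \<in> (- \<int>\<^sub>\<le>\<^sub>0 :: complex set)"
  have "open (- \<int>\<^sub>\<le>\<^sub>0 :: complex set)" by (simp add: closed_nonpos_Ints open_Compl)
  with x obtain d where d: "d > 0" "cball x d \<subseteq> - \<int>\<^sub>\<le>\<^sub>0" using open_contains_cball by metis
  obtain \<delta> where \<delta>: "\<delta> > 0" "\<And>\<alpha>' n. \<alpha>' \<in> cball x d \<Longrightarrow> \<delta> \<le> norm (\<alpha>' + of_nat n)"
    using nonpos_Ints_dist_lower_bound[of "cball x d"] d(2) by auto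
  have "uniform_limit (cball x d) (\<lambda>N \<alpha>. \<Sum>n<N. (- z) ^ n / (fact n * (\<alpha> + of_nat n)))
          (\<lambda>\<alpha>. \<Sum>n. (- z) ^ n / (fact n * (\<alpha> + of_nat n))) sequentially"
    by (rule Weierstrass_m_test[OF norm_lower_gamma_ser_term_le summable_exp_majorant]) (use \<delta> in auto)
  with d show "\<exists>d>0. cball x d \<subseteq> - \<int>\<^sub>\<le>\<^sub>0 \<and> uniform_limit (cball x d) (\<lambda>N \<alpha>. \<Sum>n<N. (- z) ^ n / (fact n * (\<alpha> + of_nat n)))
          (\<lambda>\<alpha>. lower_gamma_ser \<alpha> z) sequentially" unfolding lower_gamma_ser_def by blast
qed

lemma upper_inc_gamma_has_field_derivative:
  assumes "\<alpha> \<notin> \<int>\<^sub>\<le>\<^sub>0" "z \<notin> \<real>\<^sub>\<le>\<^sub>0"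
  shows "(upper_inc_gamma \<alpha> has_field_derivative - (z powr (\<alpha> - 1) * exp (- z))) (at z within S)"
  unfolding upper_inc_gamma_def
  by (rule derivative_eq_intros lower_inc_gamma_has_field_derivative[OF assms, of 1, THEN DERIV_subset, simplified] refl | simp)+

lemma upper_inc_gamma_recurrence:
  assumes "\<alpha> \<notin> \<int>\<^sub>\<le>\<^sub>0" "z \<noteq> 0"
  shows "upper_inc_gamma (\<alpha> + 1) z = \<alpha> * upper_inc_gamma \<alpha> z + z powr \<alpha> * exp (- z)"
proof -
  have "Gamma (\<alpha> + 1) = \<alpha> * Gamma \<alpha>" by (rule Gamma_plus1[OF assms(1)])
  thus ?thesis unfolding upper_inc_gamma_def lower_gamma_ser_recurrence[OF assms(1), symmetric]
    using assms(2) by (simp add: powr_add algebra_simps)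
qed

text \<open>Here Euler's integral over \<open>(0, \<infinity>)\<close> converges, and its part over \<open>(0, T)\<close> is the lower incomplete
  gamma function.\<close>

lemma upper_inc_gamma_tendsto_0_if_Re_pos:
  assumes "Re \<alpha> > 0"
  shows "((\<lambda>T. upper_inc_gamma \<alpha> (of_real T)) \<longlongrightarrow> 0) at_top"
proof -
  define f where "f = (\<lambda>t. complex_of_real t powr (\<alpha> - 1) / of_real (exp t))"
  define L where "L = (\<lambda>T. complex_of_real T powr \<alpha> * lower_gamma_ser \<alpha> (of_real T))"
  have \<alpha>: "\<alpha> \<notin> \<int>\<^sub>\<le>\<^sub>0" using assms by (auto elim!: nonpos_Ints_cases)
  have L: "(f has_integral L T) {0..T}" if "T > 0" for T
  proof -
    have "(f has_integral (L T - L 0)) {0..T}"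
    proof (rule fundamental_theorem_of_calculus_interior)
      show "continuous_on {0..T} L" unfolding L_def using assms \<alpha>
        by (intro continuous_intros) auto
      fix x assume "x \<in> {0<..<T}"
      thus "(L has_vector_derivative f x) (at x)"
        using lower_inc_gamma_has_vector_derivative[OF \<alpha>, of x 1 UNIV]
        by (simp add: L_def f_def exp_minus exp_of_real[symmetric] field_simps)
    qed (use that in auto)
    thus ?thesis by (simp add: L_def)
  qed
  have "(f has_integral Gamma \<alpha>) {0..}" unfolding f_def by (rule Gamma_integral_complex) fact
  hence *: "\<forall>e>0. \<exists>B>0. \<forall>a b. ball 0 B \<subseteq> cbox a b \<longrightarrow>
        norm (integral (cbox a b) (\<lambda>x. if x \<in> {0..} then f x else 0) - Gamma \<alpha>) < e"
    by (subst (asm) has_integral_alt') blast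
  have "((\<lambda>T. L T) \<longlongrightarrow> Gamma \<alpha>) at_top"
  proof (rule tendstoI)
    fix e :: real assume "e > 0"
    with * obtain B where B: "B > 0" "\<And>a b. ball 0 B \<subseteq> cbox a b \<Longrightarrow>
        norm (integral (cbox a b) (\<lambda>x. if x \<in> {0..} then f x else 0) - Gamma \<alpha>) < e" by metis
    have "dist (L T) (Gamma \<alpha>) < e" if T: "T \<ge> B" for T
    proof -
      have "integral (cbox (-T) T) (\<lambda>x. if x \<in> {0..} then f x else 0) = integral ({0..} \<inter> cbox (-T) T) f"
        by (rule integral_restrict_Int)
      also have "{0..} \<inter> cbox (-T) T = {0..T}" using T B(1) by auto
      also have "integral {0..T} f = L T" using L[of T] T B(1) by (simp add: integral_unique)
      finally have eq: "integral (cbox (-T) T) (\<lambda>x. if x \<in> {0..} then f x else 0) = L T" .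
      have "ball 0 B \<subseteq> cbox (-T) T" using T by (auto simp: dist_norm)
      from B(2)[OF this] show ?thesis unfolding eq by (simp add: dist_norm)
    qed
    thus "eventually (\<lambda>T. dist (L T) (Gamma \<alpha>) < e) at_top" using eventually_ge_at_top by (rule eventually_mono[rotated])
  qed
  hence "((\<lambda>T. Gamma \<alpha> - L T) \<longlongrightarrow> Gamma \<alpha> - Gamma \<alpha>) at_top" by (intro tendsto_intros)
  thus ?thesis by (simp add: upper_inc_gamma_def L_def)
qed

text \<open>Division by \<open>\<alpha>\<close> in the recurrence moves the statement one unit to the left at a
  time, until it covers every \<open>\<alpha>\<close> for which the function is defined.\<close>

lemma upper_inc_gamma_tendsto_0_real:
  assumes "\<alpha> \<notin> \<int>\<^sub>\<le>\<^sub>0"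
  shows "((\<lambda>T. upper_inc_gamma \<alpha> (of_real T)) \<longlongrightarrow> 0) at_top"
proof -
  obtain n where "- Re \<alpha> < real n" using reals_Archimedean2 by blast
  hence "Re \<alpha> + real n > 0" by simp
  thus ?thesis using assms
  proof (induction n arbitrary: \<alpha>)
    case 0
    thus ?case using upper_inc_gamma_tendsto_0_if_Re_pos by simp
  next
    case (Suc n)
    have a1: "\<alpha> + 1 \<notin> \<int>\<^sub>\<le>\<^sub>0" using Suc.prems by (metis plus_one_in_nonpos_Ints_imp)
    have nz: "\<alpha> \<noteq> 0" using Suc.prems by auto
    have "((\<lambda>T. of_real T powr \<alpha> * exp (- complex_of_real T)) \<longlongrightarrow> 0) at_top"
    proof (rule Lim_null_comparison)
      show "((\<lambda>T. T powr Re \<alpha> * exp (- T)) \<longlongrightarrow> 0) at_top" by real_asymp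
      show "\<forall>\<^sub>F x in at_top. norm (complex_of_real x powr \<alpha> * exp (- complex_of_real x)) \<le> x powr Re \<alpha> * exp (- x)"
        using eventually_gt_at_top[of 0] by eventually_elim (simp add: norm_mult norm_powr_real_powr)
    qed
    moreover have "((\<lambda>T. upper_inc_gamma (\<alpha> + 1) (of_real T)) \<longlongrightarrow> 0) at_top"
      by (rule Suc.IH) (use Suc.prems a1 in \<open>simp_all add: algebra_simps\<close>)
    ultimately have "((\<lambda>T. (upper_inc_gamma (\<alpha> + 1) (of_real T) - of_real T powr \<alpha> * exp (- complex_of_real T)) / \<alpha>)
        \<longlongrightarrow> (0 - 0) / \<alpha>) at_top" using nz by (intro tendsto_intros)
    moreover have "\<forall>\<^sub>F T in at_top. (upper_inc_gamma (\<alpha> + 1) (of_real T) - of_real T powr \<alpha> * exp (- complex_of_real T)) / \<alpha>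
        = upper_inc_gamma \<alpha> (of_real T)"
      using eventually_gt_at_top[of 0] 
    proof eventually_elim
      case (elim T)
      thus ?case using upper_inc_gamma_recurrence[OF Suc.prems(2), of "of_real T"] nz by simp
    qed
    ultimately show ?case by (simp add: tendsto_cong)
  qed
qed

lemma norm_powr_halfplane_le:
  assumes "Re z \<ge> 0" "z \<noteq> 0"
  shows "norm (z powr \<beta>) \<le> norm z powr Re \<beta> * exp (pi / 2 * \<bar>Im \<beta>\<bar>)"
proof -
  have "\<bar>Arg z\<bar> \<le> pi / 2" using assms Re_Ln_pos_le[of z] by (simp add: Arg_eq_Im_Ln)
  hence "\<bar>Im \<beta>\<bar> * \<bar>Arg z\<bar> \<le> \<bar>Im \<beta>\<bar> * (pi / 2)" by (rule mult_left_mono) simp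
  hence "\<bar>Im \<beta> * Arg z\<bar> \<le> \<bar>Im \<beta>\<bar> * (pi / 2)" by (simp only: abs_mult)
  hence "- Im \<beta> * Arg z \<le> pi / 2 * \<bar>Im \<beta>\<bar>" by (simp add: abs_le_iff mult_ac)
  thus ?thesis unfolding norm_powr_complex by (intro mult_left_mono) auto
qed

text \<open>On a vertical segment of fixed length the derivative is of size \<open>exp (- T)\<close> up to a power of \<open>T\<close>,
  so the limit along the real axis passes to parallel lines.\<close>

lemma upper_inc_gamma_tendsto_0_vertical:
  assumes \<alpha>: "\<alpha> \<notin> \<int>\<^sub>\<le>\<^sub>0"
  shows "((\<lambda>T. upper_inc_gamma \<alpha> (of_real T + \<i> * of_real y)) \<longlongrightarrow> 0) at_top"
proof -
  let ?r = "\<bar>Re \<alpha> - 1\<bar>" and ?E = "exp (pi / 2 * \<bar>Im \<alpha>\<bar>)"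
  have bd: "norm (upper_inc_gamma \<alpha> (of_real T + \<i> * of_real y) - upper_inc_gamma \<alpha> (of_real T))
       \<le> ((T + \<bar>y\<bar>) powr ?r * ?E * exp (- T)) * \<bar>y\<bar>" if T: "T \<ge> 1" for T
  proof -
    let ?S = "closed_segment (of_real T) (of_real T + \<i> * of_real y)"
    have S: "Re z = T" "norm z \<le> T + \<bar>y\<bar>" "norm z \<ge> 1" if "z \<in> ?S" for z
    proof -
      obtain u where u: "0 \<le> u" "u \<le> 1"
        and z: "z = (1 - u) *\<^sub>R of_real T + u *\<^sub>R (of_real T + \<i> * of_real y)"
        using \<open>z \<in> ?S\<close> unfolding closed_segment_def by blast
      have u: "0 \<le> u" "u \<le> 1" "z = of_real T + of_real u * (\<i> * of_real y)"
        using u z by (simp_all add: scaleR_conv_of_real algebra_simps)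
      show "Re z = T" using u by simp
      have "norm z \<le> norm (complex_of_real T) + norm (of_real u * (\<i> * complex_of_real y))"
        unfolding u(3) by (rule norm_triangle_ineq)
      also have "\<dots> = T + u * \<bar>y\<bar>" using T u by (simp add: norm_mult)
      also have "u * \<bar>y\<bar> \<le> \<bar>y\<bar>" using u by (simp add: mult_left_le_one_le)
      finally show "norm z \<le> T + \<bar>y\<bar>" by simp
      show "norm z \<ge> 1" using abs_Re_le_cmod[of z] \<open>Re z = T\<close> T by simp
    qed
    have "norm (upper_inc_gamma \<alpha> (of_real T + \<i> * of_real y) - upper_inc_gamma \<alpha> (of_real T))
       \<le> ((T + \<bar>y\<bar>) powr ?r * ?E * exp (- T)) * norm ((of_real T + \<i> * of_real y) - complex_of_real T)"
    proof (rule field_differentiable_bound)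
      fix z assume z: "z \<in> ?S"
      have nn: "z \<notin> \<real>\<^sub>\<le>\<^sub>0" using S(1)[OF z] T by (auto elim!: nonpos_Reals_cases)
      show "(upper_inc_gamma \<alpha> has_field_derivative - (z powr (\<alpha> - 1) * exp (- z))) (at z within ?S)"
        by (rule upper_inc_gamma_has_field_derivative[OF \<alpha> nn])
      have "norm (z powr (\<alpha> - 1)) \<le> norm z powr Re (\<alpha> - 1) * exp (pi / 2 * \<bar>Im (\<alpha> - 1)\<bar>)"
        by (rule norm_powr_halfplane_le) (use S[OF z] T in auto)
      also have "norm z powr Re (\<alpha> - 1) \<le> norm z powr ?r"
        using S(3)[OF z] by (intro powr_mono) auto
      also have "\<dots> \<le> (T + \<bar>y\<bar>) powr ?r"
        using S(2)[OF z] by (intro powr_mono2) auto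
      finally show "norm (- (z powr (\<alpha> - 1) * exp (- z))) \<le> (T + \<bar>y\<bar>) powr ?r * ?E * exp (- T)"
        using S(1)[OF z] by (simp add: norm_mult)
    qed auto
    thus ?thesis by (simp add: norm_mult)
  qed
  have "((\<lambda>T. upper_inc_gamma \<alpha> (of_real T + \<i> * of_real y) - upper_inc_gamma \<alpha> (of_real T)) \<longlongrightarrow> 0) at_top"
  proof (rule Lim_null_comparison)
    show "\<forall>\<^sub>F T in at_top. norm (upper_inc_gamma \<alpha> (of_real T + \<i> * of_real y) - upper_inc_gamma \<alpha> (of_real T))
       \<le> ((T + \<bar>y\<bar>) powr ?r * ?E * exp (- T)) * \<bar>y\<bar>"
      using eventually_ge_at_top[of 1] by eventually_elim (rule bd)
    show "((\<lambda>T. ((T + \<bar>y\<bar>) powr ?r * ?E * exp (- T)) * \<bar>y\<bar>) \<longlongrightarrow> 0) at_top"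
    proof -
      define Y r E where "Y = \<bar>y\<bar>" "r = ?r" "E = ?E"
      have "((\<lambda>T. (T + Y) powr r * exp (- T)) \<longlongrightarrow> 0) at_top" by real_asymp
      from tendsto_mult_left_zero[OF this, of "E * Y"] show ?thesis unfolding Y_r_E_def by (simp add: mult_ac)
    qed
  qed
  from tendsto_add[OF this upper_inc_gamma_tendsto_0_real[OF \<alpha>]] show ?thesis by simp
qed

text \<open>Only positive \<open>r\<close> needs more than monotonicity. There the point is
  \<open>1 + t / y0 \<le> (1 + 2 * p / y0) * (1 + t / (2 * p))\<close>, whose last factor is at most \<open>exp (t / (2 * p))\<close>
  and so contributes \<open>exp (t / 2)\<close> after raising to the power \<open>p\<close>. That loses only half of the
  exponential decay available in the next lemma.\<close>

lemma powr_shift_le_exp: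
  fixes p y0 y t r :: real
  assumes "p > 0" "r \<le> p" "y0 > 0" "\<bar>y\<bar> \<ge> y0" "t \<ge> 0"
  shows "norm (of_real t + \<i> * of_real y) powr r \<le> \<bar>y\<bar> powr r * (1 + 2 * p / y0) powr p * exp (t / 2)"
proof -
  let ?z = "of_real t + \<i> * of_real y"
  have K: "(1 + 2 * p / y0) powr p \<ge> 1" using assms by (intro ge_one_powr_ge_zero) auto
  show ?thesis
  proof (cases "r \<le> 0")
    case True
    have "\<bar>y\<bar> \<le> norm ?z" using abs_Im_le_cmod[of ?z] by simp
    hence "norm ?z powr r \<le> \<bar>y\<bar> powr r * 1" using assms True by (simp add: powr_mono2')
    also have "\<dots> \<le> \<bar>y\<bar> powr r * ((1 + 2 * p / y0) powr p * exp (t / 2))"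
      using K assms mult_mono[of 1 "(1 + 2 * p / y0) powr p" 1 "exp (t/2)"] by (intro mult_left_mono) auto
    finally show ?thesis by (simp add: mult_ac)
  next
    case False
    have "norm ?z \<le> t + \<bar>y\<bar>" using norm_triangle_ineq[of "of_real t" "\<i> * of_real y"] assms by (simp add: norm_mult)
    also have "\<dots> \<le> \<bar>y\<bar> * (1 + t / y0)"
      using assms mult_right_mono[of y0 "\<bar>y\<bar>" "t / y0"] by (simp add: algebra_simps)
    finally have "norm ?z powr r \<le> (\<bar>y\<bar> * (1 + t / y0)) powr r" using False by (intro powr_mono2) auto
    also have "\<dots> = \<bar>y\<bar> powr r * (1 + t / y0) powr r" using assms by (simp add: powr_mult)
    also have "(1 + t / y0) powr r \<le> (1 + t / y0) powr p" using assms by (intro powr_mono) auto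
    also have "\<dots> \<le> ((1 + 2 * p / y0) * exp (t / (2 * p))) powr p"
    proof (rule powr_mono2)
      have "1 + t / y0 \<le> (1 + 2 * p / y0) * (1 + t / (2 * p))"
        using assms by (simp add: field_simps)
      also have "\<dots> \<le> (1 + 2 * p / y0) * exp (t / (2 * p))" using assms by (intro mult_left_mono exp_ge_add_one_self) auto
      finally show "1 + t / y0 \<le> (1 + 2 * p / y0) * exp (t / (2 * p))" .
    qed (use assms in auto)
    also have "\<dots> = (1 + 2 * p / y0) powr p * exp (t / 2)"
      using assms by (simp add: powr_mult) (simp add: powr_def)
    finally show ?thesis by (simp add: mult_ac mult_right_mono)
  qed
qed

text \<open>The function tends to \<open>0\<close> along the horizontal ray that starts at \<open>\<i> * y\<close>, so its value at the
  start is bounded by the integral of the norm of its derivative. The primitive of the majorant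
  \<open>K * exp (- t / 2)\<close> contributes the factor \<open>2\<close>. This replaces the rotation of the path
  of an oscillatory integral into the direction of exponential decay.\<close>

lemma upper_inc_gamma_imaginary_bound:
  assumes \<alpha>: "\<alpha> \<notin> \<int>\<^sub>\<le>\<^sub>0" and p: "p > 0" "Re \<alpha> - 1 \<le> p" and y: "y0 > 0" "\<bar>y\<bar> \<ge> y0"
  shows "norm (upper_inc_gamma \<alpha> (\<i> * of_real y)) \<le>
           2 * (1 + 2 * p / y0) powr p * exp (pi / 2 * \<bar>Im \<alpha>\<bar>) * \<bar>y\<bar> powr (Re \<alpha> - 1)"
proof -
  define K where "K = \<bar>y\<bar> powr (Re \<alpha> - 1) * (1 + 2 * p / y0) powr p * exp (pi / 2 * \<bar>Im \<alpha>\<bar>)"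
  have K: "K \<ge> 0" unfolding K_def by auto
  define g where "g = (\<lambda>t. upper_inc_gamma \<alpha> (of_real t + \<i> * of_real y))"
  define g' where "g' = (\<lambda>t. - ((of_real t + \<i> * of_real y) powr (\<alpha> - 1) * exp (- (of_real t + \<i> * of_real y))))"
  have y0: "y \<noteq> 0" using y by auto
  have der: "(g has_vector_derivative g' t) (at t within S)" for t S
  proof -
    have "of_real t + \<i> * of_real y \<notin> (\<real>\<^sub>\<le>\<^sub>0 :: complex set)"
      using y0 by (auto simp: complex_eq_iff elim!: nonpos_Reals_cases)
    from upper_inc_gamma_has_field_derivative[OF \<alpha> this]
    have "((\<lambda>z. upper_inc_gamma \<alpha> (z + \<i> * of_real y)) has_field_derivative g' t) (at (of_real t))"
      unfolding g'_def by (rule DERIV_chain2[where g = "\<lambda>z. z + _" and Db = 1, simplified]) (auto intro!: derivative_eq_intros)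
    thus ?thesis unfolding g_def by (rule has_vector_derivative_real_field)
  qed
  have bd: "norm (g' t) \<le> K * exp (- t / 2)" if "t \<ge> 0" for t
  proof -
    let ?z = "of_real t + \<i> * of_real y"
    have "norm (?z powr (\<alpha> - 1)) \<le> norm ?z powr Re (\<alpha> - 1) * exp (pi / 2 * \<bar>Im (\<alpha> - 1)\<bar>)"
      by (rule norm_powr_halfplane_le) (use that y0 in \<open>auto simp: complex_eq_iff\<close>)
    also have "\<dots> \<le> (\<bar>y\<bar> powr (Re \<alpha> - 1) * (1 + 2 * p / y0) powr p * exp (t / 2)) * exp (pi / 2 * \<bar>Im \<alpha>\<bar>)"
      using powr_shift_le_exp[OF p y that] by simp
    also have "\<dots> = K * exp (t / 2)" by (simp add: K_def)
    finally have "norm (?z powr (\<alpha> - 1)) * exp (- t) \<le> K * exp (t / 2) * exp (- t)"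
      by (intro mult_right_mono) auto
    also have "\<dots> = K * exp (- t / 2)" by (simp add: mult.assoc exp_add[symmetric])
    finally show ?thesis by (simp add: g'_def norm_mult)
  qed
  have ev: "norm (g 0) \<le> 2 * K + norm (g T)" if "T > 0" for T
  proof -
    have "norm (g T - g 0) \<le> (- 2 * K * exp (- T / 2)) - (- 2 * K * exp (- 0 / 2))"
    proof (rule differentiable_bound_general[where f' = g' and \<phi>' = "\<lambda>t. K * exp (- t / 2)"])
      show "continuous_on {0..T} g" by (rule continuous_on_vector_derivative) (rule der)
      show "continuous_on {0..T} (\<lambda>a. - 2 * K * exp (- a / 2))" by (intro continuous_intros) auto
      fix x assume "0 < x" "x < T"
      show "((\<lambda>a. - 2 * K * exp (- a / 2)) has_vector_derivative K * exp (- x / 2)) (at x)"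
        unfolding has_real_derivative_iff_has_vector_derivative[symmetric]
        by (auto intro!: derivative_eq_intros)
    qed (use that der bd in auto)
    also have "\<dots> \<le> 2 * K" using K by simp
    finally have "norm (g T - g 0) \<le> 2 * K" .
    thus ?thesis using norm_triangle_sub[of "g 0" "g T"] by (simp add: norm_minus_commute)
  qed
  have "((\<lambda>T. 2 * K + norm (g T)) \<longlongrightarrow> 2 * K + norm (0::complex)) at_top"
    unfolding g_def by (intro tendsto_intros upper_inc_gamma_tendsto_0_vertical \<alpha>)
  hence "norm (g 0) \<le> 2 * K + norm (0::complex)"
    by (rule tendsto_lowerbound) (auto intro: eventually_mono[OF eventually_gt_at_top[of 0] ev])
  thus ?thesis by (simp add: g_def K_def mult_ac)
qed

section \<open>Tails of the Mellin transform of an exponential\<close>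

text \<open>The continuation in \<open>s\<close> of the integral of \<open>exp (\<i> * w * x) * x powr (- s - 1)\<close> over \<open>(d, \<infinity>)\<close>:
  the integral over \<open>(0, \<infinity>)\<close> minus the integral over \<open>(0, d)\<close>, each replaced by its meromorphic
  continuation.\<close>

definition osc_tail :: "real \<Rightarrow> real \<Rightarrow> complex \<Rightarrow> complex" where
  "osc_tail w d s = (- \<i> * of_real w) powr s * Gamma (- s) -
     of_real d powr (- s) * lower_gamma_ser (- s) (- \<i> * of_real w * of_real d)"

lemma uminus_notin_nonpos_Ints_iff: "- s \<notin> \<int>\<^sub>\<le>\<^sub>0 \<longleftrightarrow> s \<notin> (\<nat> :: complex set)"
proof -
  have "- s \<in> \<int>\<^sub>\<le>\<^sub>0 \<longleftrightarrow> s \<in> \<nat>"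
    by (auto elim!: nonpos_Ints_cases' Nats_cases simp: minus_of_nat_in_nonpos_Ints)
  thus ?thesis by simp
qed

lemma osc_tail_conv_upper_inc_gamma:
  assumes "w \<noteq> 0" "d > 0"
  shows "osc_tail w d s = (- \<i> * of_real w) powr s * upper_inc_gamma (- s) (\<i> * of_real (- w * d))"
proof -
  have "(\<i> * of_real (- w * d)) powr (- s) = (of_real d * (- \<i> * of_real w)) powr (- s)"
    by (simp add: mult_ac)
  also have "\<dots> = of_real d powr (- s) * (- \<i> * of_real w) powr (- s)"
    using assms by (intro powr_times_real_left) auto
  finally have "(- \<i> * of_real w) powr s * (\<i> * of_real (- w * d)) powr (- s) = of_real d powr (- s)"
    using assms by (simp add: powr_minus)
  thus ?thesis
    by (simp add: osc_tail_def upper_inc_gamma_def algebra_simps)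
qed

text \<open>The powers of \<open>w\<close> from the prefactor and from the incomplete gamma function
  combine to \<open>1 / \<bar>w\<bar>\<close>. With \<open>w\<close> proportional to \<open>k\<close> this is the decay that makes the series converge absolutely.\<close>

lemma osc_tail_bound:
  assumes s: "s \<notin> \<nat>" and wd: "d > 0" "y0 > 0" "\<bar>w\<bar> * d \<ge> y0" and p: "p > 0" "- Re s - 1 \<le> p"
  shows "norm (osc_tail w d s) \<le>
    2 * (1 + 2 * p / y0) powr p * exp (pi * \<bar>Im s\<bar>) * d powr (- Re s - 1) / \<bar>w\<bar>"
proof -
  have w: "w \<noteq> 0" using wd by auto
  let ?K = "2 * (1 + 2 * p / y0) powr p" and ?E = "exp (pi / 2 * \<bar>Im s\<bar>)"
  have "norm (osc_tail w d s) = norm ((- \<i> * of_real w) powr s) * norm (upper_inc_gamma (- s) (\<i> * of_real (- w * d)))"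
    using wd w by (simp add: osc_tail_conv_upper_inc_gamma norm_mult)
  also have "\<dots> \<le> (\<bar>w\<bar> powr Re s * ?E) * (?K * ?E * (\<bar>w\<bar> * d) powr (- Re s - 1))"
  proof (rule mult_mono)
    show "norm ((- \<i> * of_real w) powr s) \<le> \<bar>w\<bar> powr Re s * ?E"
      using norm_powr_halfplane_le[of "- \<i> * of_real w" s] w by (simp add: norm_mult)
    show "norm (upper_inc_gamma (- s) (\<i> * of_real (- w * d))) \<le> ?K * ?E * (\<bar>w\<bar> * d) powr (- Re s - 1)"
      using upper_inc_gamma_imaginary_bound[of "- s" p y0 "- w * d"] s p wd
      by (simp add: uminus_notin_nonpos_Ints_iff abs_mult)
  qed auto
  also have "\<dots> = ?K * (?E * ?E) * (\<bar>w\<bar> powr Re s * \<bar>w\<bar> powr (- Re s - 1)) * d powr (- Re s - 1)"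
    using wd by (simp add: powr_mult mult_ac)
  also have "?E * ?E = exp (pi * \<bar>Im s\<bar>)" by (simp add: exp_add[symmetric])
  also have "\<bar>w\<bar> powr Re s * \<bar>w\<bar> powr (- Re s - 1) = 1 / \<bar>w\<bar>"
    using w by (simp add: powr_add[symmetric] powr_minus_divide)
  finally show ?thesis by simp
qed

lemma holomorphic_on_osc_tail:
  assumes "w \<noteq> 0" "d > 0"
  shows "osc_tail w d holomorphic_on - \<nat>"
proof -
  have 1: "(\<lambda>s. Gamma (- s)) holomorphic_on - \<nat>"
    using uminus_notin_nonpos_Ints_iff by (intro holomorphic_intros) auto
  have "((\<lambda>\<alpha>. lower_gamma_ser \<alpha> (- \<i> * of_real w * of_real d)) \<circ> uminus) holomorphic_on - \<nat>"
    by (rule holomorphic_on_compose_gen[OF _ holomorphic_on_lower_gamma_ser])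
       (use uminus_notin_nonpos_Ints_iff in \<open>auto intro!: holomorphic_intros\<close>)
  hence 2: "(\<lambda>s. lower_gamma_ser (- s) (- \<i> * of_real w * of_real d)) holomorphic_on - \<nat>"
    by (simp add: o_def)
  show ?thesis unfolding osc_tail_def[abs_def]
    by (intro holomorphic_on_diff holomorphic_on_mult 1 2) (use assms in \<open>auto intro!: holomorphic_intros\<close>)
qed

lemma osc_tail_has_vector_derivative:
  assumes "s \<notin> \<nat>" "x > 0"
  shows "((\<lambda>x. osc_tail w x s) has_vector_derivative
     - (of_real x powr (- s - 1) * exp (\<i> * of_real (w * x)))) (at x within S)"
proof -
  have "- s \<notin> \<int>\<^sub>\<le>\<^sub>0" using assms by (simp add: uminus_notin_nonpos_Ints_iff)
  from has_vector_derivative_diff[OF has_vector_derivative_const[of "(- \<i> * of_real w) powr s * Gamma (- s)"]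
      lower_inc_gamma_has_vector_derivative[OF this assms(2), of "- \<i> * of_real w" S]]
  show ?thesis unfolding osc_tail_def by (simp add: mult_ac)
qed

section \<open>Hypergeometric series and the lower incomplete gamma function\<close>

lemma imaginary_even_power:
  "(\<i> * complex_of_real y) ^ (2 * n) = of_real (- ((y / 2) ^ 2)) ^ n * 2 ^ (2 * n)"
proof -
  have "(\<i> * complex_of_real y) ^ 2 = of_real (- ((y / 2) ^ 2)) * 2 ^ 2"
    by (simp add: power_mult_distrib power_divide)
  thus ?thesis by (simp only: power_mult power_mult_distrib)
qed

text \<open>The quotient of the two Pochhammer symbols that contain \<open>s\<close> telescopes to a single
  linear factor, and \<open>pochhammer (1 / 2) n\<close> turns \<open>fact n\<close> into \<open>fact (2 * n)\<close>; with \<open>3 / 2\<close> in the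
  odd case it becomes \<open>fact (2 * n + 1)\<close>.\<close>

lemma hypergeom_1F2_even_term:
  fixes s :: complex
  assumes "s \<notin> \<nat>"
  shows "(\<i> * of_real y) ^ (2 * n) / (fact (2 * n) * (of_nat (2 * n) - s)) =
    (- 1 / s) * (pochhammer (- s / 2) n / (pochhammer (1 / 2) n * pochhammer (1 - s / 2) n) *
      ((of_real (- ((y / 2) ^ 2))) ^ n / fact n))"
proof -
  let ?P = "pochhammer (- s / 2) n" and ?Q = "pochhammer (1 - s / 2) n"
  have nz: "s \<noteq> of_nat m" for m using assms by auto
  have nz1: "of_nat n - s / 2 \<noteq> 0" using nz[of "2 * n"] by (auto simp: field_simps)
  have s0: "s \<noteq> 0" using nz[of 0] by simp
  have PQ: "?P * (of_nat n - s / 2) = (- s / 2) * ?Q"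
    using pochhammer_rec[of "- s / 2" n] pochhammer_rec'[of "- s / 2" n] by (simp add: algebra_simps)
  hence P: "?P = (- s / 2) * ?Q / (of_nat n - s / 2)"
    by (subst nonzero_eq_divide_eq[OF nz1]) (rule PQ)
  have "?Q \<noteq> 0"
  proof
    assume "?Q = 0"
    then obtain k where "1 - s / 2 = - of_nat k" by (auto simp: pochhammer_eq_0_iff)
    hence "s = of_nat (2 * k + 2)" by (simp add: field_simps)
    with nz show False by blast
  qed
  hence "?P / (pochhammer (1 / 2) n * ?Q) = (- s / 2) / ((of_nat n - s / 2) * pochhammer (1 / 2) n)"
    unfolding P by simp
  also have "\<dots> = - s / ((of_nat (2 * n) - s) * pochhammer (1 / 2) n)"
  proof -
    have "of_nat n - s / 2 = (of_nat (2 * n) - s) / 2" by (simp add: field_simps)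
    thus ?thesis by (simp only:) simp
  qed
  finally have "?P / (pochhammer (1 / 2) n * ?Q) = - s / ((of_nat (2 * n) - s) * pochhammer (1 / 2) n)" .
  moreover have "(\<i> * complex_of_real y) ^ (2 * n) = of_real (- ((y / 2) ^ 2)) ^ n * 2 ^ (2 * n)"
    by (rule imaginary_even_power)
  ultimately show ?thesis using s0 by (simp add: fact_double del: of_nat_mult)
qed

lemma hypergeom_1F2_odd_term:
  fixes s :: complex
  assumes "s \<notin> \<nat>"
  shows "(\<i> * of_real y) ^ (2 * n + 1) / (fact (2 * n + 1) * (of_nat (2 * n + 1) - s)) =
    (\<i> * of_real y / (1 - s)) * (pochhammer ((1 - s) / 2) n / (pochhammer (3 / 2) n * pochhammer (1 + (1 - s) / 2) n) *
      ((of_real (- ((y / 2) ^ 2))) ^ n / fact n))"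
proof -
  let ?P = "pochhammer ((1 - s) / 2) n" and ?Q = "pochhammer (1 + (1 - s) / 2) n"
  have nz: "s \<noteq> of_nat m" for m using assms by auto
  have nz1: "of_nat n + (1 - s) / 2 \<noteq> 0" using nz[of "2 * n + 1"] by (auto simp: field_simps)
  have s0: "1 - s \<noteq> 0" using nz[of 1] by simp
  have PQ: "?P * (of_nat n + (1 - s) / 2) = ((1 - s) / 2) * ?Q"
    using pochhammer_rec[of "(1 - s) / 2" n] pochhammer_rec'[of "(1 - s) / 2" n] by (simp add: algebra_simps)
  hence P: "?P = ((1 - s) / 2) * ?Q / (of_nat n + (1 - s) / 2)"
    by (subst nonzero_eq_divide_eq[OF nz1]) (rule PQ)
  have "?Q \<noteq> 0"
  proof
    assume "?Q = 0"
    then obtain k where "1 + (1 - s) / 2 = - of_nat k" by (auto simp: pochhammer_eq_0_iff)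
    hence "s = of_nat (2 * k + 3)" by (simp add: field_simps)
    with nz show False by blast
  qed
  hence "?P / (pochhammer (3 / 2) n * ?Q) = ((1 - s) / 2) / ((of_nat n + (1 - s) / 2) * pochhammer (3 / 2) n)"
    unfolding P by simp
  also have "\<dots> = (1 - s) / ((of_nat (2 * n + 1) - s) * pochhammer (3 / 2) n)"
  proof -
    have "of_nat n + (1 - s) / 2 = (of_nat (2 * n + 1) - s) / 2" by (simp add: field_simps)
    moreover have "(x / 2) / (u / 2 * v) = x / (u * v)" for x u v :: complex by simp
    ultimately show ?thesis by (simp only:)
  qed
  finally have 1: "?P / (pochhammer (3 / 2) n * ?Q) = (1 - s) / ((of_nat (2 * n + 1) - s) * pochhammer (3 / 2) n)" .
  have 2: "(\<i> * complex_of_real y) ^ (2 * n + 1) = \<i> * of_real y * (of_real (- ((y / 2) ^ 2)) ^ n * 2 ^ (2 * n))"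
    by (simp only: power_add power_one_right imaginary_even_power) (simp only: mult_ac)
  have h: "pochhammer (1/2) n * (1 / 2 + of_nat n) = (1 / 2) * pochhammer (3/2 :: complex) n"
    using pochhammer_rec[of "1 / 2 :: complex" n] pochhammer_rec'[of "1 / 2 :: complex" n] by (simp add: algebra_simps)
  have "pochhammer (3/2 :: complex) n = 2 * (pochhammer (1/2) n * (1 / 2 + of_nat n))" unfolding h by simp
  hence "pochhammer (3/2) n = (of_nat (2 * n + 1) :: complex) * pochhammer (1/2) n"
    by (simp add: algebra_simps)
  hence 3: "fact (2 * n + 1) = 2 ^ (2 * n) * pochhammer (3 / 2) n * (fact n :: complex)"
    by (simp add: fact_double del: of_nat_mult of_nat_add)
  show ?thesis unfolding 1 2 3 using s0 by (simp del: of_nat_mult of_nat_add of_nat_Suc)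
qed

text \<open>Splitting the series into even and odd indices separates cosine and sine, that is, the two
  hypergeometric functions.\<close>

lemma lower_gamma_ser_imaginary_conv_1F2:
  assumes s: "s \<notin> \<nat>"
  shows "lower_gamma_ser (- s) (- \<i> * of_real y) =
    \<i> * of_real y / (1 - s) * hypergeom_1F2 ((1 - s) / 2) (3 / 2) (1 + (1 - s) / 2) (of_real (- ((y / 2) ^ 2)))
    - hypergeom_1F2 (- s / 2) (1 / 2) (1 - s / 2) (of_real (- ((y / 2) ^ 2))) / s"
proof -
  let ?f = "\<lambda>n. (\<i> * of_real y) ^ n / (fact n * (of_nat n - s))"
  have s': "- s \<notin> \<int>\<^sub>\<le>\<^sub>0" using s by (simp add: uminus_notin_nonpos_Ints_iff)
  have f: "?f sums lower_gamma_ser (- s) (- \<i> * of_real y)"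
    using lower_gamma_ser_sums[OF s', of "- \<i> * of_real y"] by simp
  have n: "summable (\<lambda>n. norm (?f n))"
    using lower_gamma_ser_summable_norm[OF s', of "- \<i> * of_real y"] by simp
  have sub: "summable (\<lambda>n. ?f (g n))" if "inj g" for g :: "nat \<Rightarrow> nat"
    using summable_reindex[OF n that] by - (rule summable_norm_cancel, simp add: o_def)
  have e: "summable (\<lambda>n. ?f (2 * n))" and o: "summable (\<lambda>n. ?f (2 * n + 1))"
    using sub[of "\<lambda>n. 2 * n"] sub[of "\<lambda>n. 2 * n + 1"] by (simp_all add: inj_on_def)
  have "(\<lambda>n. sum ?f {n * 2..<n * 2 + 2}) sums lower_gamma_ser (- s) (- \<i> * of_real y)"
    by (rule sums_group[OF f]) simp
  also have "(\<lambda>n. sum ?f {n * 2..<n * 2 + 2}) = (\<lambda>n. ?f (2 * n) + ?f (2 * n + 1))"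
  proof
    fix n :: nat
    have "{n * 2..<n * 2 + 2} = {2 * n, 2 * n + 1}" by auto
    thus "sum ?f {n * 2..<n * 2 + 2} = ?f (2 * n) + ?f (2 * n + 1)" by simp
  qed
  finally have "lower_gamma_ser (- s) (- \<i> * of_real y) = (\<Sum>n. ?f (2 * n)) + (\<Sum>n. ?f (2 * n + 1))"
    by (rule sums_unique2[OF _ sums_add[OF e[THEN summable_sums] o[THEN summable_sums]]])
  moreover have "(\<Sum>n. ?f (2 * n)) = (- 1 / s) * hypergeom_1F2 (- s / 2) (1 / 2) (1 - s / 2) (of_real (- ((y / 2) ^ 2)))"
  proof -
    have nz: "- 1 / s \<noteq> 0" using s by auto
    show ?thesis unfolding hypergeom_1F2_def
      using e unfolding hypergeom_1F2_even_term[OF s] by (rule suminf_mult[OF summable_mult_D[OF _ nz]])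
  qed
  moreover have "(\<Sum>n. ?f (2 * n + 1)) = (\<i> * of_real y / (1 - s)) * hypergeom_1F2 ((1 - s) / 2) (3 / 2) (1 + (1 - s) / 2) (of_real (- ((y / 2) ^ 2)))"
  proof (cases "y = 0")
    case False
    have "s \<noteq> 1" using s by auto
    hence nz: "\<i> * of_real y / (1 - s) \<noteq> 0" using False by auto
    show ?thesis unfolding hypergeom_1F2_def
      using o unfolding hypergeom_1F2_odd_term[OF s] by (rule suminf_mult[OF summable_mult_D[OF _ nz]])
  qed simp
  ultimately show ?thesis by simp
qed

lemma raw_term_conv_osc_tail:
  assumes "s \<notin> \<nat>" "d > 0" "k > 0"
  shows "raw_term a b d k s = 1 / (2 * \<i> * of_nat k) *
    (exp (2 * of_real pi * \<i> * of_real b * of_nat k) * osc_tail (2 * pi * real k * a) d s -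
     exp (- 2 * of_real pi * \<i> * of_real b * of_nat k) * osc_tail (- (2 * pi * real k * a)) d s)"
proof -
  let ?y = "2 * pi * real k * a * d"
  let ?e = "exp (2 * of_real pi * \<i> * of_real b * of_nat k)" and ?e' = "exp (- 2 * of_real pi * \<i> * of_real b * of_nat k)"
  define H1 where "H1 = hypergeom_1F2 (- s / 2) (1 / 2) (1 - s / 2) (of_real (- (pi\<^sup>2 * a\<^sup>2 * d\<^sup>2 * (real k)\<^sup>2)))"
  define H2 where "H2 = hypergeom_1F2 ((1 - s) / 2) (3 / 2) (1 + (1 - s) / 2) (of_real (- (pi\<^sup>2 * a\<^sup>2 * d\<^sup>2 * (real k)\<^sup>2)))"
  have y: "(?y / 2) ^ 2 = pi\<^sup>2 * a\<^sup>2 * d\<^sup>2 * (real k)\<^sup>2" "(- ?y / 2) ^ 2 = pi\<^sup>2 * a\<^sup>2 * d\<^sup>2 * (real k)\<^sup>2"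
    by (simp_all add: power2_eq_square)
  have L1: "lower_gamma_ser (- s) (- \<i> * of_real ?y) = \<i> * of_real ?y / (1 - s) * H2 - H1 / s"
    using lower_gamma_ser_imaginary_conv_1F2[OF assms(1), of ?y] unfolding y H1_def H2_def .
  have L2: "lower_gamma_ser (- s) (- \<i> * of_real (- ?y)) = - \<i> * of_real ?y / (1 - s) * H2 - H1 / s"
    using lower_gamma_ser_imaginary_conv_1F2[OF assms(1), of "- ?y"] unfolding y H1_def H2_def by simp
  have pw: "(- \<i> * of_real (2 * pi * real k * a')) powr s = of_nat k powr s * of_real (2 * pi) powr s * (- \<i> * of_real a') powr s" for a'
  proof -
    have "(- \<i> * of_real (2 * pi * real k * a')) powr s = (of_real (2 * pi * real k) * (- \<i> * of_real a')) powr s"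
      by (simp add: mult_ac)
    also have "\<dots> = of_real (real k * (2 * pi)) powr s * (- \<i> * of_real a') powr s"
      by (subst powr_times_real_left) (simp_all add: mult_ac)
    also have "complex_of_real (real k * (2 * pi)) powr s = (of_real (real k) * of_real (2 * pi)) powr s" by simp
    also have "\<dots> = of_real (real k) powr s * of_real (2 * pi) powr s"
      by (rule powr_times_real) auto
    finally show ?thesis by simp
  qed
  have kp: "of_nat k powr (s - 1) = of_nat k powr s / (of_nat k :: complex)" using assms by (simp add: powr_diff)
  have dp: "of_real d powr (- s) = 1 / of_real d powr s" "of_real d powr (1 - s) = of_real d / of_real d powr s"
    using assms by (simp_all add: powr_diff powr_minus_divide)
  have Euler: "exp (\<i> * of_real t) = of_real (cos t) + \<i> * of_real (sin t)" for t
    by (simp add: exp_Euler cos_of_real sin_of_real)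
  have e1: "?e = of_real (cos (2 * pi * b * real k)) + \<i> * of_real (sin (2 * pi * b * real k))"
    unfolding Euler[symmetric] by (rule arg_cong[of _ _ exp]) simp
  have "?e' = of_real (cos (- (2 * pi * b * real k))) + \<i> * of_real (sin (- (2 * pi * b * real k)))"
    unfolding Euler[symmetric] by (rule arg_cong[of _ _ exp]) simp
  hence e2: "?e' = of_real (cos (2 * pi * b * real k)) - \<i> * of_real (sin (2 * pi * b * real k))"
    by simp
  have o1: "osc_tail (2 * pi * real k * a) d s = of_nat k powr s * of_real (2 * pi) powr s * (- \<i> * of_real a) powr s * Gamma (- s)
     - (\<i> * of_real ?y / (1 - s) * H2 - H1 / s) / of_real d powr s"
    unfolding osc_tail_def pw L1[symmetric] dp by (simp add: mult_ac)
  have o2: "osc_tail (- (2 * pi * real k * a)) d s = of_nat k powr s * of_real (2 * pi) powr s * (\<i> * of_real a) powr s * Gamma (- s)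
     - (- \<i> * of_real ?y / (1 - s) * H2 - H1 / s) / of_real d powr s"
    using pw[of "- a"] unfolding osc_tail_def L2[symmetric] dp by (simp add: mult_ac)
  have nz: "s \<noteq> 0" "1 - s \<noteq> 0" "of_real d powr s \<noteq> 0" "(of_nat k :: complex) \<noteq> 0" using assms by auto
  define dd where "dd = of_real d powr s"
  define G where "G = of_nat k powr s * of_real (2 * pi) powr s * Gamma (- s)"
  define A1 where "A1 = (- \<i> * of_real a) powr s"
  define A2 where "A2 = (\<i> * of_real a) powr s"
  define E1 where "E1 = ?e"
  define E2 where "E2 = ?e'"
  define c where "c = 1 / (2 * \<i> * of_nat k)"
  define Y where "Y = of_real ?y / (1 - s) * H2 / dd"
  define Z where "Z = H1 / s / dd"
  define sn where "sn = complex_of_real (sin (2 * pi * b * real k))"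
  define cs where "cs = complex_of_real (cos (2 * pi * b * real k))"
  have "raw_term a b d k s =
    sn / (dd * s * of_nat k) * H1 -
     2 * of_real pi * of_real a * (of_real d / dd) * cs / (1 - s) * H2 +
     G / of_nat k * (1 / (2 * \<i>)) * (A1 * E1 - A2 * E2)"
    unfolding raw_term_def H1_def[symmetric] H2_def[symmetric] kp dp G_def dd_def sn_def cs_def A1_def A2_def E1_def E2_def by simp
  also have "sn / (dd * s * of_nat k) * H1 = sn * Z / of_nat k" by (simp add: Z_def)
  also have "2 * of_real pi * of_real a * (of_real d / dd) * cs / (1 - s) * H2 = cs * Y / of_nat k"
    using nz by (simp add: Y_def mult_ac)
  also have "sn * Z / of_nat k - cs * Y / of_nat k = c * (2 * \<i> * (sn * Z - cs * Y))"
    using nz by (simp add: c_def diff_divide_distrib)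
  also have "2 * \<i> * (sn * Z - cs * Y) = E2 * (- (\<i> * Y) - Z) - E1 * (\<i> * Y - Z)"
    unfolding E1_def E2_def e1 e2 sn_def[symmetric] cs_def[symmetric] by (simp add: algebra_simps)
  also have "G / of_nat k * (1 / (2 * \<i>)) * (A1 * E1 - A2 * E2) = c * (G * (A1 * E1 - A2 * E2))"
    unfolding c_def using nz by (simp add: field_simps)
  also have "c * (E2 * (- (\<i> * Y) - Z) - E1 * (\<i> * Y - Z)) + c * (G * (A1 * E1 - A2 * E2)) =
      c * (E1 * (G * A1 - (\<i> * Y - Z)) - E2 * (G * A2 - (- (\<i> * Y) - Z)))"
    by (simp add: algebra_simps)
  finally have "raw_term a b d k s = c * (E1 * (G * A1 - (\<i> * Y - Z)) - E2 * (G * A2 - (- (\<i> * Y) - Z)))" .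
  moreover have "osc_tail (2 * pi * real k * a) d s = G * A1 - (\<i> * Y - Z)"
    unfolding o1 G_def A1_def Y_def Z_def dd_def by (simp add: diff_divide_distrib mult_ac)
  moreover have "osc_tail (- (2 * pi * real k * a)) d s = G * A2 - (- (\<i> * Y) - Z)"
    unfolding o2 G_def A2_def Y_def Z_def dd_def by (simp add: diff_divide_distrib mult_ac)
  ultimately show ?thesis unfolding E1_def E2_def c_def by simp
qed

section \<open>Removing the singularities of the terms\<close>

lemma open_Compl_Nats_Diff: "open (- (\<nat> - {z}) :: complex set)"
proof -
  have "\<nat> - {z} = (of_nat ` {n. of_nat n \<noteq> z} :: complex set)" by (auto elim!: Nats_cases)
  thus ?thesis using closed_of_nat_image[of "{n. of_nat n \<noteq> z}", where 'a = complex] by (simp add: open_Compl)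
qed

lemma eventually_at_notin_Nats: "eventually (\<lambda>w. w \<notin> \<nat>) (at (z :: complex))"
  unfolding eventually_at_topological
  by (rule exI[of _ "- (\<nat> - {z})"]) (use open_Compl_Nats_Diff in auto)

text \<open>Identities proved away from the poles of \<open>Gamma (- s)\<close> are carried over to the
  natural numbers by continuity.\<close>

lemma isCont_eqI_off_Nats:
  fixes f g :: "complex \<Rightarrow> complex"
  assumes "isCont f z" "isCont g z" "\<And>w. w \<notin> \<nat> \<Longrightarrow> f w = g w"
  shows "f z = g z"
proof -
  have "eventually (\<lambda>w. f w = g w) (at z)"
    using eventually_at_notin_Nats by (rule eventually_mono) (rule assms(3))
  hence "(g \<longlongrightarrow> f z) (at z)" using assms(1) unfolding isCont_def by (rule Lim_transform_eventually[rotated])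
  with assms(2) show ?thesis unfolding isCont_def by (metis at_neq_bot tendsto_unique)
qed

text \<open>The common majorant of all terms, up to the factor \<open>1 / k\<^sup>2\<close>. Here \<open>p\<close> bounds \<open>- Re s - 1\<close> from above and
  \<open>y0\<close> bounds \<open>2 * pi * \<bar>a\<bar> * d\<close> from below; keeping both free lets one estimate serve for fixed
  parameters and for whole regions.\<close>

definition term_bound :: "real \<Rightarrow> real \<Rightarrow> real \<Rightarrow> real \<Rightarrow> complex \<Rightarrow> real" where
  "term_bound p y0 a d s = 2 * (1 + 2 * p / y0) powr p * exp (pi * \<bar>Im s\<bar>) * d powr (- Re s - 1) / (2 * pi * \<bar>a\<bar>)"

lemma norm_raw_term_le:
  assumes s: "s \<notin> \<nat>" and k: "k > 0" and d: "d > 0" "y0 > 0" "2 * pi * \<bar>a\<bar> * d \<ge> y0"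
    and p: "p > 0" "- Re s - 1 \<le> p"
  shows "norm (raw_term a b d k s) \<le> term_bound p y0 a d s / real k ^ 2"
proof -
  let ?w = "2 * pi * real k * a" and ?K = "2 * (1 + 2 * p / y0) powr p"
  let ?e = "exp (2 * of_real pi * \<i> * of_real b * of_nat k)" and ?e' = "exp (- 2 * of_real pi * \<i> * of_real b * of_nat k)"
  have "2 * pi * \<bar>a\<bar> * d * 1 \<le> 2 * pi * \<bar>a\<bar> * d * real k" using k d by (intro mult_left_mono) auto
  also have "\<dots> = \<bar>?w\<bar> * d" by (simp add: abs_mult)
  finally have wd: "y0 \<le> \<bar>?w\<bar> * d" using d(3) by simp
  define B where "B = ?K * exp (pi * \<bar>Im s\<bar>) * d powr (- Re s - 1) / \<bar>?w\<bar>"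
  have bd: "norm (osc_tail ?w d s) \<le> B" "norm (osc_tail (- ?w) d s) \<le> B"
    using osc_tail_bound[OF s d(1,2) wd p] osc_tail_bound[OF s d(1,2) _ p, of "- ?w"] wd
    unfolding B_def abs_minus_cancel by blast+
  have e: "norm ?e = 1" "norm ?e' = 1" by (simp_all add: norm_exp_eq_Re)
  have "norm (raw_term a b d k s) = 1 / (2 * real k) * norm (?e * osc_tail ?w d s - ?e' * osc_tail (- ?w) d s)"
    using k by (simp add: raw_term_conv_osc_tail[OF s d(1)] norm_mult norm_divide)
  also have "norm (?e * osc_tail ?w d s - ?e' * osc_tail (- ?w) d s) \<le> norm (?e * osc_tail ?w d s) + norm (?e' * osc_tail (- ?w) d s)"
    by (rule norm_triangle_ineq4)
  also have "\<dots> \<le> B + B" using bd e by (simp add: norm_mult)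
  also have "1 / (2 * real k) * (B + B) = term_bound p y0 a d s / real k ^ 2"
    using k by (simp add: B_def term_bound_def abs_mult power2_eq_square field_simps)
  finally show ?thesis by (simp add: divide_right_mono)
qed

lemma holomorphic_on_raw_term:
  assumes "a \<noteq> 0" "d > 0" "k > 0"
  shows "raw_term a b d k holomorphic_on - \<nat>"
proof (rule holomorphic_transform)
  show "(\<lambda>s. 1 / (2 * \<i> * of_nat k) *
    (exp (2 * of_real pi * \<i> * of_real b * of_nat k) * osc_tail (2 * pi * real k * a) d s -
     exp (- 2 * of_real pi * \<i> * of_real b * of_nat k) * osc_tail (- (2 * pi * real k * a)) d s)) holomorphic_on - \<nat>"
    by (intro holomorphic_on_mult holomorphic_on_diff holomorphic_on_const holomorphic_on_osc_tail)
       (use assms in auto)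
qed (use assms in \<open>auto simp: raw_term_conv_osc_tail\<close>)

lemma raw_term_analytic_at:
  assumes "a \<noteq> 0" "d > 0" "k > 0" "s \<notin> \<nat>"
  shows "raw_term a b d k analytic_on {s}"
  unfolding analytic_at
  by (intro exI[of _ "- \<nat>"] conjI holomorphic_on_raw_term)
     (use assms closed_Nats in \<open>auto simp: open_Compl\<close>)

lemma series_term_eq_raw_term:
  assumes "a \<noteq> 0" "d > 0" "k > 0" "s \<notin> \<nat>"
  shows "series_term a b d k s = raw_term a b d k s"
  unfolding series_term_def by (rule remove_sings_at_analytic[OF raw_term_analytic_at[OF assms]])

lemma continuous_term_bound: "d > 0 \<Longrightarrow> isCont (term_bound p y0 a d) s"
  unfolding term_bound_def[abs_def] divide_inverse by (intro continuous_intros) auto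

text \<open>The bound for the term does not blow up near a natural number, although its
  single parts do, so the singularity is removable.\<close>

lemma raw_term_removable:
  assumes "a \<noteq> 0" "d > 0" "k > 0" "s \<in> \<nat>"
  obtains c where "raw_term a b d k \<midarrow>s\<rightarrow> c" "isolated_singularity_at (raw_term a b d k) s"
proof -
  let ?f = "raw_term a b d k" and ?S = "- (\<nat> - {s})"
  have hol: "?f holomorphic_on (?S - {s})"
    by (rule holomorphic_on_subset[OF holomorphic_on_raw_term]) (use assms in auto)
  have int: "s \<in> interior ?S" using open_Compl_Nats_Diff by (simp add: interior_open)
  define y0 where "y0 = 2 * pi * \<bar>a\<bar> * d"
  have y0: "y0 > 0" using assms by (simp add: y0_def)
  have Re: "Re s \<ge> 0" using assms(4) by (auto elim!: Nats_cases)
  have "(term_bound 1 y0 a d \<longlongrightarrow> term_bound 1 y0 a d s) (at s)"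
    using continuous_term_bound[OF assms(2)] by (simp add: isCont_def)
  hence "eventually (\<lambda>w. term_bound 1 y0 a d w < term_bound 1 y0 a d s + 1) (at s)"
    by (rule order_tendstoD) simp
  moreover have "eventually (\<lambda>w. Re w > -1) (at s)"
    by (rule order_tendstoD(1)[OF tendsto_Re[OF tendsto_ident_at]]) (use Re in simp)
  moreover note eventually_at_notin_Nats[of s]
  ultimately have "eventually (\<lambda>w. norm (?f w) \<le> (term_bound 1 y0 a d s + 1) / real k ^ 2) (at s)"
  proof eventually_elim
    case (elim w)
    have "norm (?f w) \<le> term_bound 1 y0 a d w / real k ^ 2"
      by (rule norm_raw_term_le) (use elim assms y0 in \<open>auto simp: y0_def\<close>)
    also have "\<dots> \<le> (term_bound 1 y0 a d s + 1) / real k ^ 2" using elim by (intro divide_right_mono) auto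
    finally show ?case .
  qed
  hence "\<exists>B. eventually (\<lambda>z. norm (?f z) \<le> B) (at s)" by blast
  then obtain g where g: "g holomorphic_on ?S" "\<And>z. z \<in> ?S - {s} \<Longrightarrow> g z = ?f z"
    using holomorphic_on_extend_bounded[OF hol int] by blast
  have "g \<midarrow>s\<rightarrow> g s"
    using g(1) open_Compl_Nats_Diff[of s] by (metis Compl_iff DiffD2 continuous_on_eq_continuous_at holomorphic_on_imp_continuous_on insertI1 isCont_def)
  moreover have "eventually (\<lambda>z. g z = ?f z) (at s)"
    using eventually_at_notin_Nats[of s] eventually_neq_at_within by eventually_elim (rule g(2), auto)
  ultimately have "?f \<midarrow>s\<rightarrow> g s" by (rule Lim_transform_eventually)
  moreover have "isolated_singularity_at ?f s"
    by (rule isolated_singularity_at_holomorphic[OF hol]) (use open_Compl_Nats_Diff in auto)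
  ultimately show ?thesis using that by blast
qed

lemma holomorphic_on_series_term:
  assumes "a \<noteq> 0" "d > 0" "k > 0"
  shows "series_term a b d k holomorphic_on UNIV"
proof -
  have "series_term a b d k analytic_on {s}" for s
  proof (cases "s \<in> \<nat>")
    case True
    from raw_term_removable[OF assms True, of b] show ?thesis
      unfolding series_term_def using remove_sings_analytic_at by blast
  next
    case False
    show ?thesis unfolding series_term_def
      by (rule remove_sings_analytic_on[OF raw_term_analytic_at[OF assms False]])
  qed
  hence "series_term a b d k analytic_on UNIV" using analytic_on_analytic_at by blast
  thus ?thesis by (rule analytic_imp_holomorphic)
qed

lemma isCont_series_term:
  assumes "a \<noteq> 0" "d > 0" "k > 0"
  shows "isCont (series_term a b d k) s"
  using holomorphic_on_imp_continuous_on[OF holomorphic_on_series_term[OF assms]]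
  by (simp add: continuous_on_eq_continuous_at)

lemma norm_series_term_le:
  assumes ak: "a \<noteq> 0" "k > 0" and d: "d > 0" "y0 > 0" "2 * pi * \<bar>a\<bar> * d \<ge> y0"
    and p: "p > 0" "- Re s - 1 < p"
  shows "norm (series_term a b d k s) \<le> term_bound p y0 a d s / real k ^ 2"
proof -
  have "eventually (\<lambda>w. Re w > - 1 - p) (at s)"
    by (rule order_tendstoD(1)[OF tendsto_Re[OF tendsto_ident_at]]) (use p in simp)
  with eventually_at_notin_Nats[of s] have "eventually (\<lambda>w. norm (series_term a b d k w) \<le> term_bound p y0 a d w / real k ^ 2) (at s)"
  proof eventually_elim
    case (elim w)
    show ?case unfolding series_term_eq_raw_term[OF ak(1) d(1) ak(2) elim(1)]
      by (rule norm_raw_term_le) (use elim ak d p in auto)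
  qed
  note ev = this
  have lb: "((\<lambda>w. term_bound p y0 a d w / real k ^ 2) \<longlongrightarrow> term_bound p y0 a d s / real k ^ 2) (at s)"
    using continuous_term_bound[OF d(1)] ak by (intro tendsto_intros) (auto simp: isCont_def)
  have ls: "((\<lambda>w. norm (series_term a b d k w)) \<longlongrightarrow> norm (series_term a b d k s)) (at s)"
    using isCont_series_term[OF ak(1) d(1) ak(2)] by (intro tendsto_norm) (simp add: isCont_def)
  show ?thesis by (rule tendsto_le[OF at_neq_bot lb ls ev])
qed

lemma raw_term_uminus: "raw_term (- a) (- b) d k s = - raw_term a b d k s"
proof -
  have gen: "(- S) / q * H1 - 2 * P * (- A) * D * C / r * H2 + K * (Y - X) =
     - (S / q * H1 - 2 * P * A * D * C / r * H2 + K * (X - Y))" for S q H1 P A D C r H2 K X Y :: complex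
    by (simp add: algebra_simps)
  have sub: "- \<i> * of_real (- a) = \<i> * of_real a" "\<i> * of_real (- a) = - \<i> * of_real a"
    "2 * of_real pi * \<i> * of_real (- b) * of_nat k = - 2 * of_real pi * \<i> * of_real b * of_nat k"
    "- 2 * of_real pi * \<i> * of_real (- b) * of_nat k = 2 * of_real pi * \<i> * of_real b * of_nat k"
    "complex_of_real (sin (2 * pi * (- b) * real k)) = - of_real (sin (2 * pi * b * real k))"
    "cos (2 * pi * (- b) * real k) = cos (2 * pi * b * real k)"
    "(- a)\<^sup>2 = a\<^sup>2" by simp_all
  have a: "complex_of_real (- a) = - of_real a" by simp
  show ?thesis unfolding raw_term_def sub unfolding a by (rule gen)
qed

lemma series_term_uminus:
  assumes "a \<noteq> 0" "d > 0" "k > 0"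
  shows "series_term (- a) (- b) d k s = - series_term a b d k s"
  by (rule isCont_eqI_off_Nats[where f = "series_term (- a) (- b) d k"])
     (use assms in \<open>auto intro!: continuous_intros isCont_series_term simp: series_term_eq_raw_term raw_term_uminus\<close>)

text \<open>Only the lower end of the integral over \<open>(d, \<infinity>)\<close> depends on \<open>d\<close>.\<close>

lemma raw_term_has_vector_derivative:
  assumes "s \<notin> \<nat>" "x > 0" "k > 0"
  shows "((\<lambda>x. raw_term a b x k s) has_vector_derivative
     - (of_real (sin (2 * pi * real k * (a * x + b)) / real k) * of_real x powr (- s - 1))) (at x)"
proof -
  let ?w = "2 * pi * real k * a"
  let ?e = "exp (2 * of_real pi * \<i> * of_real b * of_nat k)" and ?e' = "exp (- 2 * of_real pi * \<i> * of_real b * of_nat k)"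
  have gen: "1 / (2 * \<i> * K) * (e * (- (X * E)) - e' * (- (X * E'))) = - (X / K) * ((e * E - e' * E') / (2 * \<i>))"
    for K e X E e' E' :: complex
    by (simp add: diff_divide_distrib algebra_simps)
  let ?t = "2 * pi * real k * (a * x + b)"
  let ?X = "of_real x powr (- s - 1)"
  have "((\<lambda>x. 1 / (2 * \<i> * of_nat k) * (?e * osc_tail ?w x s - ?e' * osc_tail (- ?w) x s)) has_vector_derivative
     1 / (2 * \<i> * of_nat k) * (?e * (- (?X * exp (\<i> * of_real (?w * x)))) - ?e' * (- (?X * exp (\<i> * of_real (- ?w * x)))))) (at x)"
    by (intro has_vector_derivative_mult_right has_vector_derivative_diff osc_tail_has_vector_derivative assms)
  hence "((\<lambda>x. raw_term a b x k s) has_vector_derivative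
     1 / (2 * \<i> * of_nat k) * (?e * (- (?X * exp (\<i> * of_real (?w * x)))) - ?e' * (- (?X * exp (\<i> * of_real (- ?w * x)))))) (at x)"
    by (rule has_vector_derivative_transform_within_open[of _ _ _ "{0<..}"])
       (use assms in \<open>auto simp: raw_term_conv_osc_tail\<close>)
  also have "1 / (2 * \<i> * of_nat k) * (?e * (- (?X * exp (\<i> * of_real (?w * x)))) - ?e' * (- (?X * exp (\<i> * of_real (- ?w * x)))))
     = - (?X / of_nat k) * ((?e * exp (\<i> * of_real (?w * x)) - ?e' * exp (\<i> * of_real (- ?w * x))) / (2 * \<i>))"
    by (rule gen)
  also have "?e * exp (\<i> * of_real (?w * x)) = exp (\<i> * of_real ?t)"
    unfolding mult_exp_exp by (rule arg_cong[of _ _ exp]) (simp add: algebra_simps)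
  also have "?e' * exp (\<i> * of_real (- ?w * x)) = exp (- (\<i> * of_real ?t))"
    unfolding mult_exp_exp by (rule arg_cong[of _ _ exp]) (simp add: algebra_simps)
  also have "(exp (\<i> * of_real ?t) - exp (- (\<i> * of_real ?t))) / (2 * \<i>) = of_real (sin ?t)"
    unfolding sin_of_real[symmetric] sin_exp_eq by simp
  also have "- (?X / of_nat k) * of_real (sin ?t) = - (of_real (sin ?t / real k) * ?X)" by simp
  finally show ?thesis .
qed

lemma raw_term_diff_has_integral:
  assumes "s \<notin> \<nat>" "0 < d1" "d1 \<le> d2" "k > 0"
  shows "((\<lambda>x. of_real (sin (2 * pi * real k * (a * x + b)) / real k) * of_real x powr (- s - 1)) has_integral
            (raw_term a b d1 k s - raw_term a b d2 k s)) {d1..d2}"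
proof -
  have "((\<lambda>x. - (of_real (sin (2 * pi * real k * (a * x + b)) / real k) * of_real x powr (- s - 1))) has_integral
            (raw_term a b d2 k s - raw_term a b d1 k s)) {d1..d2}"
    using assms
    by (intro fundamental_theorem_of_calculus has_vector_derivative_at_within[OF raw_term_has_vector_derivative]) auto
  from has_integral_neg[OF this] show ?thesis by simp
qed

text \<open>At natural numbers \<open>s\<close> both sides are limits of the formula for \<open>raw_term\<close>: the term because it is
  entire, the integral because the interval is compact and avoids \<open>0\<close>.\<close>

lemma series_term_diff_has_integral:
  assumes "a \<noteq> 0" "0 < d1" "d1 \<le> d2" "k > 0"
  shows "((\<lambda>x. of_real (sin (2 * pi * real k * (a * x + b)) / real k) * of_real x powr (- s - 1)) has_integral
            (series_term a b d1 k s - series_term a b d2 k s)) {d1..d2}"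
proof -
  define f where "f = (\<lambda>s x. complex_of_real (sin (2 * pi * real k * (a * x + b)) / real k) * of_real x powr (- s - 1))"
  have cont: "continuous_on (UNIV \<times> cbox d1 d2) (\<lambda>(s, x). f s x)"
    unfolding f_def case_prod_unfold using assms by (intro continuous_intros) auto
  have "continuous_on UNIV (\<lambda>s. integral (cbox d1 d2) (f s))"
    by (rule integral_continuous_on_param[OF cont])
  hence 1: "isCont (\<lambda>s. integral (cbox d1 d2) (f s)) s" by (simp add: continuous_on_eq_continuous_at)
  have "integral (cbox d1 d2) (f s) = series_term a b d1 k s - series_term a b d2 k s"
  proof (rule isCont_eqI_off_Nats[OF 1])
    show "isCont (\<lambda>a'. series_term a b d1 k a' - series_term a b d2 k a') s"
      using assms by (intro continuous_intros isCont_series_term) auto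
    fix w :: complex assume "w \<notin> \<nat>"
    hence "integral (cbox d1 d2) (f w) = raw_term a b d1 k w - raw_term a b d2 k w"
      unfolding f_def cbox_interval using assms by (intro integral_unique raw_term_diff_has_integral)
    thus "integral (cbox d1 d2) (f w) = series_term a b d1 k w - series_term a b d2 k w"
      using \<open>w \<notin> \<nat>\<close> assms series_term_eq_raw_term[of a d1 k w b] series_term_eq_raw_term[of a d2 k w b] by simp
  qed
  moreover have "f s integrable_on cbox d1 d2"
    unfolding f_def cbox_interval using assms by (intro integrable_continuous_interval continuous_intros) auto
  ultimately show ?thesis unfolding f_def cbox_interval has_integral_iff by blast
qed

section \<open>Partial sums of the Fourier series of the sawtooth function\<close>

definition sawtooth_sum :: "nat \<Rightarrow> real \<Rightarrow> real" where
  "sawtooth_sum N x = (\<Sum>k<N. sin (2 * pi * real (Suc k) * x) / real (Suc k))"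

text \<open>At the integers the Fourier series takes the mean value of the jump.\<close>

definition sawtooth :: "real \<Rightarrow> real" where
  "sawtooth x = (if x \<in> \<int> then 0 else pi * (1 / 2 - frac x))"

lemma sin_two_pi_mult_add_int: "sin (2 * pi * real (Suc k) * (x + of_int m)) = sin (2 * pi * real (Suc k) * x)"
proof -
  have "2 * pi * real (Suc k) * (x + of_int m) = 2 * pi * real (Suc k) * x + 2 * pi * of_int (int (Suc k) * m)"
    by (simp add: algebra_simps)
  hence "sin (2 * pi * real (Suc k) * (x + of_int m)) = sin (2 * pi * real (Suc k) * x + 2 * pi * of_int (int (Suc k) * m))" by (rule arg_cong)
  also have "\<dots> = sin (2 * pi * real (Suc k) * x)" unfolding sin_add sin_int_2pin cos_int_2pin by simp
  finally show ?thesis .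
qed

lemma sawtooth_sum_add_int: "sawtooth_sum N (x + of_int m) = sawtooth_sum N x"
  unfolding sawtooth_sum_def sin_two_pi_mult_add_int ..

lemma sawtooth_sum_frac: "sawtooth_sum N (frac x) = sawtooth_sum N x"
  using sawtooth_sum_add_int[of N "frac x" "\<lfloor>x\<rfloor>"] by (simp add: frac_def)

lemma sawtooth_sum_uminus: "sawtooth_sum N (- x) = - sawtooth_sum N x"
  by (simp add: sawtooth_sum_def sum_negf)

lemma sawtooth_sum_reflect: "sawtooth_sum N (1 - x) = - sawtooth_sum N x"
  using sawtooth_sum_add_int[of N "- x" 1] by (simp add: sawtooth_sum_uminus)

lemma sawtooth_sum_Int: "x \<in> \<int> \<Longrightarrow> sawtooth_sum N x = 0"
proof -
  assume "x \<in> \<int>"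
  hence "sawtooth_sum N x = sawtooth_sum N 0" using sawtooth_sum_frac[of N x] frac_eq_0_iff[of x] by metis
  thus ?thesis by (simp add: sawtooth_sum_def)
qed

lemma sawtooth_sum_half: "sawtooth_sum N (1 / 2) = 0"
  using sawtooth_sum_reflect[of N "1 / 2"] by simp

lemma dirichlet_kernel:
  "2 * sin (pi * x) * (\<Sum>k<N. cos (2 * pi * real (Suc k) * x)) = sin (real (2 * N + 1) * pi * x) - sin (pi * x)"
proof (induction N)
  case (Suc N)
  have e: "2 * sin A * cos B = sin (B + A) - sin (B - A)" for A B :: real
    by (simp add: sin_add sin_diff)
  have "2 * sin (pi * x) * cos (2 * pi * real (Suc N) * x) = sin (real (2 * Suc N + 1) * pi * x) - sin (real (2 * N + 1) * pi * x)"
    unfolding e by (simp add: algebra_simps)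
  with Suc show ?case by (simp add: distrib_left)
qed simp

lemma sawtooth_sum_deriv:
  "(sawtooth_sum N has_real_derivative (2 * pi * (\<Sum>k<N. cos (2 * pi * real (Suc k) * x)))) (at x within S)"
proof -
  have 1: "((\<lambda>x. sin (2 * pi * real (Suc k) * x) / real (Suc k)) has_real_derivative
          2 * pi * cos (2 * pi * real (Suc k) * x)) (at x within S)" for k
    by (rule derivative_eq_intros refl | simp)+
  show ?thesis unfolding sawtooth_sum_def[abs_def] sum_distrib_left
    by (intro DERIV_sum 1)
qed

text \<open>Integrating the Dirichlet kernel from \<open>x\<close> to \<open>1 / 2\<close> and then integrating by parts leaves
  \<open>pi * (1 / 2 - x)\<close>, a boundary term and an integral whose
  majorant has the primitive \<open>- 1 / (M * sin (pi * x))\<close>. The proof runs this backwards: \<open>h\<close> is the difference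
  with the boundary term moved over, it vanishes at \<open>1 / 2\<close>, and its derivative is dominated.\<close>

lemma sawtooth_sum_approx_left_half:
  assumes x: "0 < x" "x \<le> 1 / 2"
  shows "\<bar>sawtooth_sum N x - pi * (1 / 2 - x)\<bar> \<le> 2 / (real (2 * N + 1) * sin (pi * x))"
proof -
  define M where "M = real (2 * N + 1)"
  have M: "M > 0" by (simp add: M_def)
  define h where "h = (\<lambda>x. sawtooth_sum N x + pi * x - pi / 2 + cos (M * pi * x) / (M * sin (pi * x)))"
  define h' where "h' = (\<lambda>x. - (cos (M * pi * x) * pi * cos (pi * x) / (M * sin (pi * x) ^ 2)))"
  have sp: "sin (pi * y) > 0" if "0 < y" "y \<le> 1 / 2" for y
    using that by (intro sin_gt_zero) (auto simp: field_simps)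
  have der: "(h has_real_derivative h' y) (at y)" if "0 < y" "y \<le> 1 / 2" for y
  proof -
    have "2 * pi * (\<Sum>k<N. cos (2 * pi * real (Suc k) * y)) = pi * (2 * sin (pi * y) * (\<Sum>k<N. cos (2 * pi * real (Suc k) * y))) / sin (pi * y)"
      using sp[OF that] by (simp add: field_simps)
    also have "\<dots> = pi * (sin (M * pi * y) - sin (pi * y)) / sin (pi * y)" unfolding dirichlet_kernel M_def ..
    finally have D: "2 * pi * (\<Sum>k<N. cos (2 * pi * real (Suc k) * y)) = pi * (sin (M * pi * y) - sin (pi * y)) / sin (pi * y)" .
    have "(h has_real_derivative 2 * pi * (\<Sum>k<N. cos (2 * pi * real (Suc k) * y)) + pi +
        ((- sin (M * pi * y) * (M * pi)) * (M * sin (pi * y)) - cos (M * pi * y) * (M * (cos (pi * y) * pi))) / (M * sin (pi * y) * (M * sin (pi * y)))) (at y)"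
      unfolding h_def using sp[OF that] M
      by (auto intro!: derivative_eq_intros sawtooth_sum_deriv)
    also have "2 * pi * (\<Sum>k<N. cos (2 * pi * real (Suc k) * y)) + pi +
        ((- sin (M * pi * y) * (M * pi)) * (M * sin (pi * y)) - cos (M * pi * y) * (M * (cos (pi * y) * pi))) / (M * sin (pi * y) * (M * sin (pi * y)))
        = h' y" unfolding D h'_def using sp[OF that] M by (simp add: field_simps power2_eq_square)
    finally show ?thesis .
  qed
  \<comment> \<open>An odd multiple of \<open>pi / 2\<close>: the choice of \<open>1 / 2\<close> as base point annihilates all boundary terms.\<close>
  have h_half: "h (1 / 2) = 0"
  proof -
    have "cos (M * pi * (1 / 2)) = 0"
      unfolding M_def cos_zero_iff by (rule disjI1, rule exI[of _ "2 * N + 1"]) simp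
    thus ?thesis by (simp add: h_def sawtooth_sum_half)
  qed
  have "\<bar>h x\<bar> \<le> 1 / (M * sin (pi * x))"
  proof (cases "x = 1 / 2")
    case False
    have "norm (h (1 / 2) - h x) \<le> (- 1 / (M * sin (pi * (1 / 2)))) - (- 1 / (M * sin (pi * x)))"
    proof (rule differentiable_bound_general[where f' = h' and \<phi>' = "\<lambda>y. pi * cos (pi * y) / (M * sin (pi * y) ^ 2)"])
      show "x < 1 / 2" using x False by simp
      show "continuous_on {x..1 / 2} h"
        by (rule DERIV_continuous_on[OF DERIV_subset[OF der]]) (use x in auto)
      have "sin (pi * y) \<noteq> 0" if "y \<in> {x..1/2}" for y using sp[of y] that x by auto
      thus "continuous_on {x..1 / 2} (\<lambda>a. - 1 / (M * sin (pi * a)))"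
        using M by (intro continuous_intros) auto
      fix y assume y: "x < y" "y < 1 / 2"
      hence y': "0 < y" "y \<le> 1 / 2" using x by auto
      show "(h has_vector_derivative h' y) (at y)"
        using der[OF y'] by (simp add: has_real_derivative_iff_has_vector_derivative)
      show "((\<lambda>a. - 1 / (M * sin (pi * a))) has_vector_derivative pi * cos (pi * y) / (M * sin (pi * y) ^ 2)) (at y)"
        unfolding has_real_derivative_iff_has_vector_derivative[symmetric]
        using sp[OF y'] M by (auto intro!: derivative_eq_intros simp: field_simps power2_eq_square)
      have c: "cos (pi * y) \<ge> 0" using y' by (intro cos_ge_zero) (auto simp: field_simps intro: order_trans[of _ 0])
      have "\<bar>cos (M * pi * y)\<bar> * (pi * cos (pi * y)) \<le> 1 * (pi * cos (pi * y))"
        using c by (intro mult_right_mono) auto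
      thus "norm (h' y) \<le> pi * cos (pi * y) / (M * sin (pi * y) ^ 2)"
        unfolding h'_def using M c by (auto simp: abs_mult intro!: divide_right_mono)
    qed
    also have "\<dots> \<le> 1 / (M * sin (pi * x))" using M by simp
    finally show ?thesis by (simp add: h_half)
  next
    case True
    show ?thesis unfolding True using h_half M by simp
  qed
  moreover have "\<bar>cos (M * pi * x) / (M * sin (pi * x))\<bar> \<le> 1 / (M * sin (pi * x))"
    using M sp[OF x] by (auto simp: abs_mult intro!: divide_right_mono)
  moreover have "sawtooth_sum N x - pi * (1 / 2 - x) = h x - cos (M * pi * x) / (M * sin (pi * x))"
    by (simp add: h_def algebra_simps)
  moreover have "2 / (M * sin (pi * x)) = 1 / (M * sin (pi * x)) + 1 / (M * sin (pi * x))" by simp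
  ultimately show ?thesis unfolding M_def[symmetric] by linarith
qed

lemma sawtooth_sum_approx:
  assumes x: "0 < x" "x < 1"
  shows "\<bar>sawtooth_sum N x - pi * (1 / 2 - x)\<bar> \<le> 2 / (real (2 * N + 1) * sin (pi * x))"
proof (cases "x \<le> 1 / 2")
  case False
  have "sin (pi * (1 - x)) = sin (pi * x)" by (simp add: algebra_simps sin_diff)
  moreover have "sawtooth_sum N x - pi * (1 / 2 - x) = - (sawtooth_sum N (1 - x) - pi * (1 / 2 - (1 - x)))"
    by (simp add: sawtooth_sum_reflect algebra_simps)
  ultimately show ?thesis using sawtooth_sum_approx_left_half[of "1 - x" N] x False by (simp only: abs_minus_cancel)
qed (use x sawtooth_sum_approx_left_half in auto)

lemma sawtooth_sum_tendsto: "(\<lambda>N. sawtooth_sum N x) \<longlonglongrightarrow> sawtooth x"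
proof (cases "x \<in> \<int>")
  case False
  define y where "y = frac x"
  have y: "0 < y" "y < 1" using False by (auto simp: y_def frac_lt_1 frac_gt_0_iff)
  define c where "c = sin (pi * y)"
  have "c > 0" unfolding c_def using y by (intro sin_gt_zero) auto
  have "(\<lambda>N. sawtooth_sum N y - pi * (1 / 2 - y)) \<longlonglongrightarrow> 0"
  proof (rule Lim_null_comparison)
    show "(\<lambda>N. 2 / (real (2 * N + 1) * c)) \<longlonglongrightarrow> 0" using \<open>c > 0\<close> by real_asymp
  qed (use sawtooth_sum_approx[OF y] in \<open>auto simp: c_def\<close>)
  from tendsto_add[OF this tendsto_const[of "pi * (1 / 2 - y)"]] show ?thesis
    using False by (simp add: sawtooth_def y_def sawtooth_sum_frac)
qed (simp add: sawtooth_def sawtooth_sum_Int)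

lemma sin_ge_half:
  assumes "0 \<le> y" "y \<le> pi / 2" shows "sin y \<ge> y / (2::real)"
proof -
  have "\<bar>sin y - (\<Sum>i<3. sin_coeff i * y ^ i)\<bar> \<le> inverse (fact 3) * \<bar>y\<bar> ^ 3" by (rule Maclaurin_sin_bound)
  hence "\<bar>sin y - y\<bar> \<le> y ^ 3 / 6" using assms by (simp add: numeral_3_eq_3 sin_coeff_def fact_numeral)
  moreover have "y ^ 3 \<le> 3 * y"
  proof -
    have "pi / 2 \<le> 1.7" using pi_approx by simp
    hence "y * y \<le> 1.7 * 1.7" using assms by (intro mult_mono) auto
    hence "y * y \<le> 3" by simp
    hence "y * (y * y) \<le> y * 3" using assms by (intro mult_left_mono) auto
    thus ?thesis by (simp add: power3_eq_cube mult_ac)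
  qed
  ultimately show ?thesis by linarith
qed

text \<open>For \<open>x\<close> above the order of \<open>1 / N\<close> the approximation is already within \<open>2\<close>; below it the
  \<open>N\<close> summands are at most \<open>2 * pi * x\<close> each. This uniform bound is what dominated convergence needs.\<close>

lemma abs_sawtooth_sum_le: "\<bar>sawtooth_sum N x\<bar> \<le> 4"
proof -
  have *: "\<bar>sawtooth_sum N x\<bar> \<le> 4" if x: "0 < x" "x \<le> 1 / 2" for x
  proof -
    have s: "sin (pi * x) \<ge> pi * x / 2" using x by (intro sin_ge_half) (auto simp: field_simps)
    define M where "M = real (2 * N + 1)"
    have M: "M > 0" by (simp add: M_def)
    show ?thesis
    proof (cases "M * (pi * x / 2) \<ge> 1")
      case True
      also have "M * (pi * x / 2) \<le> M * sin (pi * x)" using s M by (intro mult_left_mono) auto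
      finally have "2 / (M * sin (pi * x)) \<le> 2" by (simp add: divide_le_eq)
      hence "\<bar>sawtooth_sum N x - pi * (1 / 2 - x)\<bar> \<le> 2"
        using sawtooth_sum_approx_left_half[OF x, of N] unfolding M_def by linarith
      moreover have "\<bar>pi * (1 / 2 - x)\<bar> \<le> 2"
      proof -
        have "pi * \<bar>1 / 2 - x\<bar> \<le> 4 * (1 / 2)" using x pi_less_4 by (intro mult_mono) auto
        thus ?thesis by (simp add: abs_mult)
      qed
      ultimately show ?thesis by linarith
    next
      case False
      have "\<bar>sawtooth_sum N x\<bar> \<le> (\<Sum>k<N. \<bar>sin (2 * pi * real (Suc k) * x) / real (Suc k)\<bar>)"
        unfolding sawtooth_sum_def by (rule sum_abs)
      also have "\<dots> \<le> (\<Sum>k<N. 2 * pi * x)"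
      proof (rule sum_mono)
        fix k
        have "\<bar>sin (2 * pi * real (Suc k) * x)\<bar> \<le> \<bar>2 * pi * real (Suc k) * x\<bar>" by (rule abs_sin_x_le_abs_x)
        also have "\<dots> = 2 * pi * x * real (Suc k)" using x by (simp add: abs_mult)
        finally show "\<bar>sin (2 * pi * real (Suc k) * x) / real (Suc k)\<bar> \<le> 2 * pi * x"
          by (simp add: abs_divide divide_le_eq del: of_nat_Suc)
      qed
      also have "\<dots> \<le> M * (pi * x)" using x by (simp add: M_def algebra_simps)
      also have "\<dots> \<le> 4" using False by simp
      finally show ?thesis .
    qed
  qed
  define y where "y = frac x"
  have y: "0 \<le> y" "y < 1" by (auto simp: y_def frac_lt_1)
  consider "y = 0" | "0 < y" "y \<le> 1 / 2" | "y > 1 / 2" using y by linarith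
  hence "\<bar>sawtooth_sum N y\<bar> \<le> 4"
  proof cases
    case 1 thus ?thesis by (simp add: sawtooth_sum_def)
  next
    case 2 thus ?thesis by (rule *)
  next
    case 3
    thus ?thesis using *[of "1 - y"] y by (simp add: sawtooth_sum_reflect)
  qed
  thus ?thesis by (simp add: y_def sawtooth_sum_frac)
qed

text \<open>Near \<open>b\<close> the derivative of the partial sum is controlled by the Dirichlet kernel, whose denominator
  \<open>sin (pi * x)\<close> stays away from \<open>0\<close>; farther away the uniform bound suffices.\<close>

lemma sawtooth_sum_lipschitz:
  assumes "b \<notin> \<int>"
  obtains L where "L \<ge> 0" "\<And>N u. \<bar>sawtooth_sum N (b + u) - sawtooth_sum N b\<bar> \<le> L * \<bar>u\<bar>"
proof -
  define m where "m = \<bar>sin (pi * b)\<bar> / 2"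
  have "sin (pi * b) \<noteq> 0"
  proof
    assume "sin (pi * b) = 0"
    then obtain i :: int where "pi * b = of_int i * pi" by (auto simp: sin_zero_iff_int2)
    hence "b = of_int i" by simp
    with assms show False by simp
  qed
  hence m: "m > 0" by (simp add: m_def)
  have "continuous (at b) (\<lambda>x. \<bar>sin (pi * x)\<bar>)" by (intro continuous_intros)
  hence "((\<lambda>x. \<bar>sin (pi * x)\<bar>) \<longlongrightarrow> \<bar>sin (pi * b)\<bar>) (nhds b)"
    unfolding continuous_at by (subst (asm) tendsto_at_iff_tendsto_nhds[of "\<lambda>x. \<bar>sin (pi * x)\<bar>" b])
  hence "eventually (\<lambda>x. \<bar>sin (pi * x)\<bar> > m) (nhds b)"
    by (rule order_tendstoD(1)) (use m in \<open>simp add: m_def\<close>)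
  then obtain \<delta> where \<delta>: "\<delta> > 0" "\<And>x. dist x b < \<delta> \<Longrightarrow> \<bar>sin (pi * x)\<bar> > m"
    by (auto simp: eventually_nhds_metric)
  define L where "L = max (2 * pi / m) (8 / \<delta>)"
  have D: "\<bar>2 * pi * (\<Sum>k<N. cos (2 * pi * real (Suc k) * y))\<bar> \<le> 2 * pi / m" if y: "dist y b < \<delta>" for N y
  proof -
    let ?C = "\<Sum>k<N. cos (2 * pi * real (Suc k) * y)"
    have "2 * m * \<bar>?C\<bar> \<le> 2 * \<bar>sin (pi * y)\<bar> * \<bar>?C\<bar>"
      using \<delta>(2)[OF y] by (intro mult_right_mono) auto
    also have "\<dots> = \<bar>sin (real (2 * N + 1) * pi * y) - sin (pi * y)\<bar>"
      unfolding dirichlet_kernel[symmetric] by (simp add: abs_mult)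
    also have "\<dots> \<le> 1 + 1" by (rule order_trans[OF abs_triangle_ineq4]) (intro add_mono abs_sin_le_one)
    finally show ?thesis using m by (simp add: abs_mult field_simps)
  qed
  show ?thesis
  proof (rule that[of L])
    show "L \<ge> 0" using m by (simp add: L_def le_max_iff_disj)
    fix N u
    show "\<bar>sawtooth_sum N (b + u) - sawtooth_sum N b\<bar> \<le> L * \<bar>u\<bar>"
    proof (cases "\<bar>u\<bar> < \<delta>")
      case True
      have "norm (sawtooth_sum N (b + u) - sawtooth_sum N b) \<le> 2 * pi / m * norm (b + u - b)"
        by (rule field_differentiable_bound[of "ball b \<delta>", OF convex_ball sawtooth_sum_deriv])
           (use D True \<delta>(1) in \<open>auto simp: dist_commute dist_norm\<close>)
      also have "\<dots> \<le> L * norm (b + u - b)" unfolding L_def by (intro mult_right_mono) auto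
      finally show ?thesis by simp
    next
      case False
      have "\<bar>sawtooth_sum N (b + u) - sawtooth_sum N b\<bar> \<le> 8"
        using abs_sawtooth_sum_le[of N "b + u"] abs_sawtooth_sum_le[of N b] by linarith
      also have "8 \<le> 8 / \<delta> * \<bar>u\<bar>" using False \<delta>(1) by (simp add: field_simps)
      also have "\<dots> \<le> L * \<bar>u\<bar>" unfolding L_def by (intro mult_right_mono) auto
      finally show ?thesis .
    qed
  qed
qed

section \<open>Integrals of the integer part\<close>

text \<open>The integrand in the definition of \<open>R\<close>.\<close>

abbreviation floor_integrand :: "real \<Rightarrow> real \<Rightarrow> complex \<Rightarrow> real \<Rightarrow> complex" where
  "floor_integrand a b s x \<equiv> of_int \<lfloor>a * x + frac b\<rfloor> * of_real x powr (- s - 1)"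

lemma floor_integrand_measurable:
  "(\<lambda>x. indicator {0<..} x *\<^sub>R floor_integrand a b s x) \<in> borel_measurable borel"
proof -
  have [measurable]: "(\<lambda>x. indicator {0<..} x *\<^sub>R (complex_of_real x powr (- s - 1))) \<in> borel_measurable borel"
    by (intro borel_measurable_continuous_on_indicator continuous_intros) auto
  have "(\<lambda>x. of_real (real_of_int \<lfloor>a * x + frac b\<rfloor>) * (indicator {0<..} x *\<^sub>R (complex_of_real x powr (- s - 1)))) \<in> borel_measurable borel"
    by measurable
  also have "(\<lambda>x. of_real (real_of_int \<lfloor>a * x + frac b\<rfloor>) * (indicator {0<..} x *\<^sub>R (complex_of_real x powr (- s - 1))))
     = (\<lambda>x. indicator {0<..} x *\<^sub>R floor_integrand a b s x)"
    by (rule ext) (simp add: indicator_def)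
  finally show ?thesis .
qed

lemma set_integrable_floor_integrand:
  assumes "0 < p" "p \<le> q"
  shows "set_integrable lborel {p..q} (floor_integrand a b s)"
proof -
  have [measurable]: "(\<lambda>x. indicator {0<..} x *\<^sub>R floor_integrand a b s x) \<in> borel_measurable borel"
    by (rule floor_integrand_measurable)
  have "compact ((\<lambda>x. complex_of_real x powr (- s - 1)) ` {p..q})"
    using assms by (intro compact_continuous_image continuous_intros) auto
  hence "bounded ((\<lambda>x. complex_of_real x powr (- s - 1)) ` {p..q})" by (rule compact_imp_bounded)
  then obtain B where B: "norm (complex_of_real x powr (- s - 1)) \<le> B" if "x \<in> {p..q}" for x
    unfolding bounded_iff by blast
  have fl: "\<bar>real_of_int \<lfloor>a * x + frac b\<rfloor>\<bar> \<le> \<bar>a\<bar> * q + 2" if x: "x \<in> {p..q}" for x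
  proof -
    have "\<bar>a * x\<bar> \<le> \<bar>a\<bar> * q" using x assms by (auto simp: abs_mult intro!: mult_left_mono)
    thus ?thesis using frac_lt_1[of b] frac_ge_0[of b] by linarith
  qed
  have "integrable lborel (\<lambda>x. indicator {p..q} x *\<^sub>R (indicator {0<..} x *\<^sub>R floor_integrand a b s x))"
  proof (rule integrableI_bounded_set_indicator[where B = "(\<bar>a\<bar> * q + 2) * B"])
    show "(\<lambda>x. indicator {0<..} x *\<^sub>R floor_integrand a b s x) \<in> borel_measurable lborel" by simp
    show "AE x in lborel. x \<in> {p..q} \<longrightarrow> norm (indicator {0<..} x *\<^sub>R floor_integrand a b s x) \<le> (\<bar>a\<bar> * q + 2) * B"
    proof (intro AE_I2 impI)
      fix x assume x: "x \<in> {p..q}"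
      have "norm (floor_integrand a b s x) \<le> (\<bar>a\<bar> * q + 2) * B"
        unfolding norm_mult norm_of_int using fl[OF x] B[OF x] by (intro mult_mono) auto
      thus "norm (indicator {0<..} x *\<^sub>R floor_integrand a b s x) \<le> (\<bar>a\<bar> * q + 2) * B"
        using x assms by (simp add: indicator_def)
    qed
  qed (use assms in auto)
  also have "(\<lambda>x. indicator {p..q} x *\<^sub>R (indicator {0<..} x *\<^sub>R floor_integrand a b s x))
      = (\<lambda>x. indicator {p..q} x *\<^sub>R floor_integrand a b s x)"
    using assms by (auto simp: fun_eq_iff indicator_def)
  finally show ?thesis unfolding set_integrable_def .
qed

lemma integrable_on_floor_integrand:
  assumes "0 < p" "p \<le> q"
  shows "floor_integrand a b s integrable_on {p..q}"
  using set_borel_integral_eq_integral(1)[OF set_integrable_floor_integrand[OF assms]] .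

text \<open>A common upper end \<open>D\<close> beyond all points involved removes the orientation of the integrals: no
  case distinction on the order of \<open>1\<close>, \<open>d\<close> and \<open>(1 - frac b) / a\<close> is needed later.\<close>

lemma R_eq_integral:
  assumes "a > 0" "d > 0" "D \<ge> d" "D \<ge> (1 - frac b) / a" "D \<ge> 1"
  shows "R a b d s = s * (integral {d..D} (floor_integrand a b s) - integral {(1 - frac b) / a..D} (floor_integrand a b s))"
proof -
  let ?u = "(1 - frac b) / a" and ?f = "floor_integrand a b s"
  have u: "?u > 0" using assms frac_lt_1[of b] by simp
  define I where "I = (\<lambda>p q :: real. CLBINT x=ereal p..ereal q. ?f x)"
  have ii: "interval_lebesgue_integrable lborel (ereal p) (ereal q) ?f" if "0 < p" "p \<le> q" for p q
    using set_integrable_floor_integrand[OF that, of a b s] that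
    by (auto simp: interval_lebesgue_integrable_def intro: set_integrable_subset)
  have split: "I p q = I p D - I q D" if "0 < p" "0 < q" "p \<le> D" "q \<le> D" for p q
  proof -
    have "I p q + I q D = I p D" unfolding I_def
      by (rule interval_integral_sum)
         (use ii[of "min p q" D] that in \<open>auto simp: min_def max_def split: if_splits\<close>)
    thus ?thesis by (metis add_diff_cancel_right')
  qed
  have I: "I p D = integral {p..D} ?f" if "0 < p" "p \<le> D" for p
    unfolding I_def using interval_integral_eq_integral[OF that(2) set_integrable_floor_integrand[OF that]] by simp
  have "R a b d s = s * (I 1 ?u - I 1 d)" by (simp only: R_def I_def one_ereal_def)
  also have "I 1 ?u - I 1 d = I d D - I ?u D"
    using split[of 1 ?u] split[of 1 d] u assms by simp
  finally show ?thesis using I u assms by simp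
qed

lemma powr_has_integral:
  assumes "0 < p" "p \<le> q" "s \<noteq> (0::complex)"
  shows "((\<lambda>x. of_real x powr (- s - 1)) has_integral ((of_real p powr (- s) - of_real q powr (- s)) / s)) {p..q}"
proof -
  have "((\<lambda>x. of_real x powr (- s - 1)) has_integral (of_real q powr (- s) / (- s) - of_real p powr (- s) / (- s))) {p..q}"
  proof (rule fundamental_theorem_of_calculus)
    fix x assume x: "x \<in> {p..q}"
    have "((\<lambda>z. z powr (- s) / (- s)) has_field_derivative (of_real x powr (- s - 1))) (at (of_real x))"
      using x assms by (auto intro!: derivative_eq_intros)
    thus "((\<lambda>x. complex_of_real x powr - s / - s) has_vector_derivative complex_of_real x powr (- s - 1)) (at x within {p..q})"
      by (rule has_vector_derivative_real_field)
  qed (use assms in auto)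
  thus ?thesis using assms by (simp add: diff_divide_distrib)
qed

text \<open>The points \<open>D j\<close> are the jumps of the integer part, which equals \<open>j + 1\<close> between \<open>D j\<close> and
  \<open>D (j + 1)\<close>. Summation by parts turns the integral of this step function into a partial sum of the
  Dirichlet series of the Hurwitz zeta function.\<close>

lemma floor_integrand_has_integral:
  fixes a b :: real and s :: complex and m :: nat
  assumes "a > 0" "s \<noteq> 0"
  defines "D \<equiv> (\<lambda>m :: nat. (real m + 1 - frac b) / a)"
  shows "(floor_integrand a b s has_integral
           ((\<Sum>j<m. of_real (D j) powr (- s)) - of_nat m * of_real (D m) powr (- s)) / s) {D 0..D m}"
proof (induction m)
  case (Suc m)
  have D0: "D k > 0" for k using assms(1) frac_lt_1[of b] by (simp add: D_def)
  have Dm: "D j \<le> D k" if "j \<le> k" for j k using assms(1) that by (simp add: D_def divide_right_mono)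
  have "(floor_integrand a b s has_integral of_nat (Suc m) * ((of_real (D m) powr (- s) - of_real (D (Suc m)) powr (- s)) / s)) {D m..D (Suc m)}"
  proof (rule has_integral_spike_finite[of "{D (Suc m)}"])
    show "((\<lambda>x. of_nat (Suc m) * complex_of_real x powr (- s - 1)) has_integral of_nat (Suc m) * ((of_real (D m) powr (- s) - of_real (D (Suc m)) powr (- s)) / s)) {D m..D (Suc m)}"
      by (intro has_integral_mult_right powr_has_integral D0 Dm assms) auto
    fix x assume "x \<in> {D m..D (Suc m)} - {D (Suc m)}"
    hence "D m \<le> x" "x < D (Suc m)" by auto
    hence "\<lfloor>a * x + frac b\<rfloor> = int (Suc m)"
      unfolding floor_eq_iff using assms(1) by (auto simp: D_def field_simps)
    thus "floor_integrand a b s x = of_nat (Suc m) * complex_of_real x powr (- s - 1)" by simp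
  qed auto
  from has_integral_combine[OF Dm Dm Suc.IH this]
  show ?case by (simp add: diff_divide_distrib ring_distribs add_divide_distrib algebra_simps)
qed auto

lemma minus_floor_shift_frac: "a * x + b - of_int \<lfloor>a * x + b\<rfloor> = a * x + frac b - of_int \<lfloor>a * x + frac b\<rfloor>" for a x b :: real
proof -
  have "a * x + b = a * x + frac b + of_int \<lfloor>b\<rfloor>" by (simp add: frac_def)
  hence "\<lfloor>a * x + b\<rfloor> = \<lfloor>a * x + frac b\<rfloor> + \<lfloor>b\<rfloor>" by (simp only: floor_add_int)
  thus ?thesis by (simp add: frac_def)
qed

lemma sawtooth_affine_notin_Ints:
  assumes "a * x + b \<notin> \<int>"
  shows "sawtooth (a * x + b) = pi * (1 / 2 - frac b - a * x + of_int \<lfloor>a * x + frac b\<rfloor>)"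
  using assms minus_floor_shift_frac[of a x b] by (simp add: sawtooth_def frac_def)

lemma countable_int_preimage:
  assumes "a \<noteq> (0::real)" shows "countable {x. a * x + b \<in> \<int>}"
proof -
  have "{x. a * x + b \<in> \<int>} \<subseteq> (\<lambda>i. (of_int i - b) / a) ` UNIV"
  proof
    fix x assume "x \<in> {x. a * x + b \<in> \<int>}"
    then obtain i where "a * x + b = of_int i" by (auto elim: Ints_cases)
    hence "x = (of_int i - b) / a" using assms by (simp add: field_simps)
    thus "x \<in> (\<lambda>i. (of_int i - b) / a) ` UNIV" by blast
  qed
  thus ?thesis by (rule countable_subset) simp
qed

lemma negligible_int_preimage: "a \<noteq> (0::real) \<Longrightarrow> negligible {x. a * x + b \<in> \<int>}"
  using countable_int_preimage by (simp add: negligible_iff_null_sets countable_imp_null_set_lborel null_sets_completionI)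

section \<open>Convergence of the series\<close>

lemma summable_inverse_Suc_squared: "summable (\<lambda>k. inverse (real (Suc k) ^ 2))"
  using inverse_power_summable[of 2, where 'a = real] by (subst summable_Suc_iff) simp

lemma norm_series_term_summable:
  assumes "a \<noteq> 0" "d > 0"
  shows "summable (\<lambda>k. norm (series_term a b d (Suc k) s))"
proof -
  define B where "B = term_bound (\<bar>Re s\<bar> + 1) (2 * pi * \<bar>a\<bar> * d) a d s"
  have "summable (\<lambda>k. B * inverse (real (Suc k) ^ 2))"
    by (rule summable_mult[OF summable_inverse_Suc_squared])
  thus ?thesis
  proof (rule summable_comparison_test'[where N = 0])
    fix k :: nat
    have "norm (series_term a b d (Suc k) s) \<le> B / real (Suc k) ^ 2"
      unfolding B_def using assms by (intro norm_series_term_le) auto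
    thus "norm (norm (series_term a b d (Suc k) s)) \<le> B * inverse (real (Suc k) ^ 2)"
      by (simp add: divide_inverse del: of_nat_Suc)
  qed
qed

lemma summable_series_term:
  "a \<noteq> 0 \<Longrightarrow> d > 0 \<Longrightarrow> summable (\<lambda>k. series_term a b d (Suc k) s)"
  by (rule summable_norm_cancel) (rule norm_series_term_summable)

text \<open>The factor \<open>d powr (- Re s - 1)\<close> is the delicate one. For \<open>d \<ge> 1\<close> its exponent is less than \<open>\<epsilon>\<close>, for \<open>d < 1\<close>
  its exponent is bounded below by means of \<open>Re s \<le> M\<close>.\<close>

lemma conv_region_bound:
  assumes "c > 0" "\<epsilon> > 0"
  obtains B where "\<And>a b d s k. (a, b, d, s) \<in> conv_region c C \<epsilon> M \<Longrightarrow>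
      norm (series_term a b d (Suc k) s) \<le> B * inverse (real (Suc k) ^ 2)"
proof -
  \<comment> \<open>The least value of \<open>2 * pi * \<bar>a\<bar> * d\<close> on the region.\<close>
  define y0 where "y0 = 2 * pi * c * c"
  have y0: "y0 > 0" using assms by (simp add: y0_def)
  define B where "B = 2 * (1 + 2 * \<epsilon> / y0) powr \<epsilon> * exp (pi * \<epsilon>) * (C powr \<epsilon> + c powr (- \<bar>M\<bar> - 1)) / (2 * pi * c)"
  have "norm (series_term a b d (Suc k) s) \<le> B * inverse (real (Suc k) ^ 2)"
    if reg: "(a, b, d, s) \<in> conv_region c C \<epsilon> M" for a b d s k
  proof -
    have r: "c \<le> \<bar>a\<bar>" "\<bar>a\<bar> \<le> C" "c \<le> d" "d \<le> C" "Re s > - \<epsilon>" "\<bar>Im s\<bar> < \<epsilon>" "d \<ge> 1 \<or> Re s \<le> M"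
      using reg by (auto simp: conv_region_def)
    have d: "d > 0" "a \<noteq> 0" using r assms by auto
    have "c * c \<le> \<bar>a\<bar> * d" using r assms by (intro mult_mono) auto
    hence yd: "y0 \<le> 2 * pi * \<bar>a\<bar> * d" unfolding y0_def by (simp add: mult.assoc)
    have "norm (series_term a b d (Suc k) s) \<le> term_bound \<epsilon> y0 a d s / real (Suc k) ^ 2"
      using r assms d y0 yd by (intro norm_series_term_le) auto
    also have "term_bound \<epsilon> y0 a d s \<le> B"
      unfolding term_bound_def B_def
    proof (intro frac_le mult_mono mult_nonneg_nonneg)
      show "d powr (- Re s - 1) \<le> C powr \<epsilon> + c powr (- \<bar>M\<bar> - 1)"
      proof (cases "d \<ge> 1")
        case True
        have "d powr (- Re s - 1) \<le> d powr \<epsilon>" using True r by (intro powr_mono) auto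
        also have "\<dots> \<le> C powr \<epsilon>" using r d assms by (intro powr_mono2) auto
        finally show ?thesis by (simp add: add_increasing2)
      next
        case False
        have "d powr (- Re s - 1) \<le> d powr (- \<bar>M\<bar> - 1)" using False r d by (intro powr_mono') auto
        also have "\<dots> \<le> c powr (- \<bar>M\<bar> - 1)" using r assms by (intro powr_mono2') auto
        finally show ?thesis by (simp add: add_increasing)
      qed
    qed (use r assms y0 in auto)
    finally show ?thesis by (simp add: divide_inverse mult_right_mono)
  qed
  thus ?thesis using that by blast
qed

lemma conv_region_uniform:
  assumes "c > 0" "\<epsilon> > 0"
  shows "uniformly_convergent_on (conv_region c C \<epsilon> M)
           (\<lambda>N (a, b, d, s). \<Sum>k<N. norm (series_term a b d (Suc k) s))" (is ?th1)
    and "uniform_limit (conv_region c C \<epsilon> M)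
          (\<lambda>N (a, b, d, s). \<Sum>k<N. series_term a b d (Suc k) s)
          (\<lambda>(a, b, d, s). \<Sum>k. series_term a b d (Suc k) s) sequentially" (is ?th2)
proof -
  obtain B where B: "\<And>a b d s k. (a, b, d, s) \<in> conv_region c C \<epsilon> M \<Longrightarrow>
      norm (series_term a b d (Suc k) s) \<le> B * inverse (real (Suc k) ^ 2)"
    using conv_region_bound[OF assms] by blast
  note sm = summable_mult[OF summable_inverse_Suc_squared, of B]
  have "uniform_limit (conv_region c C \<epsilon> M)
          (\<lambda>N p. \<Sum>k<N. case p of (a, b, d, s) \<Rightarrow> norm (series_term a b d (Suc k) s))
          (\<lambda>p. \<Sum>k. case p of (a, b, d, s) \<Rightarrow> norm (series_term a b d (Suc k) s)) sequentially"
    by (rule Weierstrass_m_test[OF _ sm]) (use B in \<open>auto simp del: of_nat_Suc\<close>)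
  hence "uniformly_convergent_on (conv_region c C \<epsilon> M)
          (\<lambda>N p. \<Sum>k<N. case p of (a, b, d, s) \<Rightarrow> norm (series_term a b d (Suc k) s))"
    by (rule uniformly_convergentI)
  thus ?th1 by (simp add: case_prod_unfold)
  have "uniform_limit (conv_region c C \<epsilon> M)
          (\<lambda>N p. \<Sum>k<N. case p of (a, b, d, s) \<Rightarrow> series_term a b d (Suc k) s)
          (\<lambda>p. \<Sum>k. case p of (a, b, d, s) \<Rightarrow> series_term a b d (Suc k) s) sequentially"
    by (rule Weierstrass_m_test[OF _ sm]) (use B in \<open>auto simp del: of_nat_Suc\<close>)
  thus ?th2 by (simp add: case_prod_unfold)
qed

text \<open>A closed disc of radius \<open>1\<close> about any point lies in a suitable \<open>conv_region\<close>, so local uniform convergence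
  comes from the uniform statement.\<close>

lemma holomorphic_on_series:
  assumes "a \<noteq> 0" "d > 0"
  shows "(\<lambda>s. \<Sum>k. series_term a b d (Suc k) s) holomorphic_on UNIV"
proof (rule holomorphic_uniform_sequence[OF open_UNIV])
  show "(\<lambda>s. \<Sum>k<N. series_term a b d (Suc k) s) holomorphic_on UNIV" for N
    by (intro holomorphic_on_sum holomorphic_on_series_term assms) auto
  fix z :: complex
  define c where "c = min \<bar>a\<bar> d"
  define \<epsilon> where "\<epsilon> = norm z + 2"
  have "c > 0" "\<epsilon> > 0" using assms by (auto simp: c_def \<epsilon>_def add_nonneg_pos)
  note unif = conv_region_uniform(2)[OF this, of "max \<bar>a\<bar> d" \<epsilon>]
  have sub: "(a, b, d, s) \<in> conv_region c (max \<bar>a\<bar> d) \<epsilon> \<epsilon>" if "s \<in> cball z 1" for s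
  proof -
    have "norm s \<le> norm z + 1" using that norm_triangle_ineq2[of s z] by (simp add: dist_norm norm_minus_commute)
    with abs_Re_le_cmod[of s] abs_Im_le_cmod[of s] show ?thesis
      by (auto simp: conv_region_def c_def \<epsilon>_def)
  qed
  have "uniform_limit (cball z 1) (\<lambda>N s. (\<lambda>(a, b, d, s). \<Sum>k<N. series_term a b d (Suc k) s) (a, b, d, s))
     (\<lambda>s. (\<lambda>(a, b, d, s). \<Sum>k. series_term a b d (Suc k) s) (a, b, d, s)) sequentially"
    by (rule uniform_limit_compose'[OF unif]) (use sub in auto)
  thus "\<exists>r>0. cball z r \<subseteq> UNIV \<and> uniform_limit (cball z r)
      (\<lambda>N s. \<Sum>k<N. series_term a b d (Suc k) s) (\<lambda>s. \<Sum>k. series_term a b d (Suc k) s) sequentially"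
    by (intro exI[of _ 1]) simp
qed

section \<open>The sum to the right of the line of real part one\<close>

text \<open>Finite partial sums of the series correspond to partial sums of the Fourier series under the
  integral, where they are bounded and converge pointwise.\<close>

lemma series_diff_has_integral:
  assumes "a \<noteq> 0" "0 < d1" "d1 \<le> d2"
  shows "((\<lambda>x. of_real (sawtooth (a * x + b)) * of_real x powr (- s - 1)) has_integral
            ((\<Sum>k. series_term a b d1 (Suc k) s) - (\<Sum>k. series_term a b d2 (Suc k) s))) {d1..d2}"
proof -
  define f where "f = (\<lambda>N x. complex_of_real (sawtooth_sum N (a * x + b)) * of_real x powr (- s - 1))"
  have f: "(f N has_integral (\<Sum>k<N. series_term a b d1 (Suc k) s) - (\<Sum>k<N. series_term a b d2 (Suc k) s)) {d1..d2}" for N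
  proof -
    have "((\<lambda>x. \<Sum>k<N. of_real (sin (2 * pi * real (Suc k) * (a * x + b)) / real (Suc k)) * of_real x powr (- s - 1)) has_integral
            (\<Sum>k<N. series_term a b d1 (Suc k) s - series_term a b d2 (Suc k) s)) {d1..d2}"
      using assms by (intro has_integral_sum series_term_diff_has_integral) auto
    thus ?thesis unfolding f_def sawtooth_sum_def of_real_sum sum_distrib_right sum_subtractf .
  qed
  have fi: "f N integrable_on {d1..d2}" for N using f by blast
  have hi: "(\<lambda>x. 4 * norm (complex_of_real x powr (- s - 1))) integrable_on {d1..d2}"
    using assms by (intro integrable_continuous_interval continuous_intros) auto
  have bd: "norm (f N x) \<le> 4 * norm (complex_of_real x powr (- s - 1))" for N x
    unfolding f_def norm_mult norm_of_real by (intro mult_right_mono abs_sawtooth_sum_le) auto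
  have cv: "(\<lambda>N. f N x) \<longlonglongrightarrow> of_real (sawtooth (a * x + b)) * of_real x powr (- s - 1)" for x
    unfolding f_def by (intro tendsto_intros sawtooth_sum_tendsto)
  note dom = dominated_convergence[OF fi hi bd cv]
  have "(\<lambda>N. integral {d1..d2} (f N)) \<longlonglongrightarrow> (\<Sum>k. series_term a b d1 (Suc k) s) - (\<Sum>k. series_term a b d2 (Suc k) s)"
    unfolding integral_unique[OF f]
    using assms by (intro tendsto_diff summable_LIMSEQ summable_series_term) auto
  from LIMSEQ_unique[OF dom(2) this] dom(1) show ?thesis by (simp add: has_integral_iff)
qed

lemma series_tendsto_0:
  assumes "a \<noteq> 0" "Re s > -1"
  shows "((\<lambda>d. \<Sum>k. series_term a b d (Suc k) s) \<longlongrightarrow> 0) at_top"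
proof -
  define y0 where "y0 = 2 * pi * \<bar>a\<bar>"
  define K where "K = 2 * (1 + 2 * 1 / y0) powr 1 * exp (pi * \<bar>Im s\<bar>) / (2 * pi * \<bar>a\<bar>)"
  define Z where "Z = (\<Sum>k. inverse (real (Suc k) ^ 2))"
  have y0: "y0 > 0" using assms by (simp add: y0_def)
  note sm = summable_inverse_Suc_squared
  have bd: "norm (\<Sum>k. series_term a b d (Suc k) s) \<le> K * d powr (- Re s - 1) * Z" if d: "d \<ge> 1" for d
  proof -
    have "norm (series_term a b d (Suc k) s) \<le> K * d powr (- Re s - 1) * inverse (real (Suc k) ^ 2)" for k
    proof -
      have "2 * pi * \<bar>a\<bar> * 1 \<le> 2 * pi * \<bar>a\<bar> * d" using d by (intro mult_left_mono) auto
      hence y0d: "2 * pi * \<bar>a\<bar> * d \<ge> y0" by (simp only: y0_def mult_1_right)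
      have "norm (series_term a b d (Suc k) s) \<le> term_bound 1 y0 a d s / real (Suc k) ^ 2"
        by (rule norm_series_term_le[OF assms(1) _ _ y0 y0d]) (use assms d in simp_all)
      also have "\<dots> = K * d powr (- Re s - 1) * inverse (real (Suc k) ^ 2)"
      proof -
        have "term_bound 1 y0 a d s = K * d powr (- Re s - 1)" unfolding term_bound_def K_def by simp
        thus ?thesis by (simp only: divide_inverse)
      qed
      finally show ?thesis .
    qed
    hence "norm (\<Sum>k. series_term a b d (Suc k) s) \<le> (\<Sum>k. K * d powr (- Re s - 1) * inverse (real (Suc k) ^ 2))"
      by (intro norm_suminf_le summable_mult sm)
    also have "\<dots> = K * d powr (- Re s - 1) * Z" unfolding Z_def by (rule suminf_mult[OF sm])
    finally show ?thesis .
  qed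
  show ?thesis
  proof (rule Lim_null_comparison)
    show "\<forall>\<^sub>F d in at_top. norm (\<Sum>k. series_term a b d (Suc k) s) \<le> K * d powr (- Re s - 1) * Z"
      using eventually_ge_at_top[of 1] by eventually_elim (rule bd)
    have "((\<lambda>d. K * d powr (- Re s - 1) * Z) \<longlongrightarrow> K * 0 * Z) at_top"
      using assms by (intro tendsto_intros tendsto_neg_powr filterlim_ident) auto
    thus "((\<lambda>d. K * d powr (- Re s - 1) * Z) \<longlongrightarrow> 0) at_top" by simp
  qed
qed

lemma hurwitz_zeta_sums:
  assumes "Re s > 1" "x > 0"
  shows "(\<lambda>k. of_real (real k + x) powr (- s)) sums hurwitz_zeta s x"
proof -
  have "summable (\<lambda>k. real k powr (- Re s))" using assms by (simp add: summable_real_powr_iff)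
  hence "summable (\<lambda>k. complex_of_real (real k + x) powr (- s))"
  proof (rule summable_comparison_test'[where N = 1])
    fix k :: nat assume "k \<ge> 1"
    have "norm (complex_of_real (real k + x) powr (- s)) = (real k + x) powr (- Re s)"
      using assms by (subst norm_powr_real_powr) auto
    also have "\<dots> \<le> real k powr (- Re s)" using assms \<open>k \<ge> 1\<close> by (intro powr_mono2') auto
    finally show "norm (complex_of_real (real k + x) powr (- s)) \<le> real k powr (- Re s)" .
  qed
  thus ?thesis unfolding hurwitz_zeta_def by (rule summable_sums)
qed

lemma sawtooth_integral:
  assumes "a > 0" "0 < d" "d \<le> D" "s \<noteq> 0" "s \<noteq> 1"
  shows "((\<lambda>x. of_real (sawtooth (a * x + b)) * of_real x powr (- s - 1)) has_integral
     of_real pi * (of_real (1 / 2 - frac b) * ((of_real d powr (- s) - of_real D powr (- s)) / s)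
       - of_real a * ((of_real d powr (1 - s) - of_real D powr (1 - s)) / (s - 1))
       + integral {d..D} (floor_integrand a b s))) {d..D}"
proof -
  have 1: "((\<lambda>x. of_real x powr (- s - 1)) has_integral ((of_real d powr (- s) - of_real D powr (- s)) / s)) {d..D}"
    by (intro powr_has_integral assms)
  have 2: "((\<lambda>x. of_real x powr (- s)) has_integral ((of_real d powr (1 - s) - of_real D powr (1 - s)) / (s - 1))) {d..D}"
    using powr_has_integral[OF assms(2,3), of "s - 1"] assms by simp
  have 3: "(floor_integrand a b s has_integral integral {d..D} (floor_integrand a b s)) {d..D}"
    using integrable_on_floor_integrand[OF assms(2,3)] by (rule integrable_integral)
  have int: "((\<lambda>x. of_real pi * (of_real (1 / 2 - frac b) * of_real x powr (- s - 1) - of_real a * of_real x powr (- s) + floor_integrand a b s x))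
    has_integral of_real pi * (of_real (1 / 2 - frac b) * ((of_real d powr (- s) - of_real D powr (- s)) / s)
       - of_real a * ((of_real d powr (1 - s) - of_real D powr (1 - s)) / (s - 1))
       + integral {d..D} (floor_integrand a b s))) {d..D}"
    by (intro has_integral_mult_right has_integral_add has_integral_diff 1 2 3)
  have neg: "negligible {x. a * x + b \<in> \<int>}" using assms by (intro negligible_int_preimage) auto
  have eq: "of_real (sawtooth (a * x + b)) * of_real x powr (- s - 1) =
      of_real pi * (of_real (1 / 2 - frac b) * of_real x powr (- s - 1) - of_real a * of_real x powr (- s) + floor_integrand a b s x)"
    if "x \<in> {d..D} - {x. a * x + b \<in> \<int>}" for x
  proof -
    have "complex_of_real x powr (- s) = of_real x * of_real x powr (- s - 1)"
      using that assms by (simp add: powr_diff)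
    moreover have "sawtooth (a * x + b) = pi * (1 / 2 - frac b - a * x + of_int \<lfloor>a * x + frac b\<rfloor>)"
      using that by (intro sawtooth_affine_notin_Ints) auto
    ultimately show ?thesis by (simp add: ring_distribs)
  qed
  show ?thesis by (rule has_integral_spike[OF neg eq int])
qed

text \<open>All expressions in the comparison of \<open>d\<close> with \<open>D m\<close> are explicit, so the sum at \<open>d\<close> is equal to \<open>G m\<close>
  for every large \<open>m\<close>. The limit of \<open>G\<close> is the asserted value: the terms at \<open>D m\<close> vanish, the one with
  the factor \<open>m\<close> because \<open>m \<le> a * D m\<close> and \<open>Re s > 1\<close>.\<close>

lemma series_term_sums_pos:
  assumes a: "a > 0" and d: "d > 0" and s: "Re s > 1"
  shows "(\<lambda>k. series_term a b d (Suc k) s) sums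
     (of_real pi / s * (of_real a powr s * hurwitz_zeta s (1 - frac b)
               - (of_real a * of_real d * s / (s - 1) + of_real (frac b) - 1 / 2) * of_real d powr (- s)
               + R a b d s))"
proof -
  have nz: "s \<noteq> 0" "s \<noteq> 1" using s by auto
  define S where "S = (\<lambda>d. \<Sum>k. series_term a b d (Suc k) s)"
  \<comment> \<open>The jumps of the integer part; \<open>D 0\<close> is the end point in the definition of \<open>R\<close>.\<close>
  define D where "D = (\<lambda>m :: nat. (real m + 1 - frac b) / a)"
  define F where "F = floor_integrand a b s"
  have fb: "frac b < 1" by (rule frac_lt_1)
  have D0: "D m > 0" for m using a fb by (simp add: D_def)
  have Dmono: "D 0 \<le> D m" for m using a by (simp add: D_def divide_right_mono)
  have Dlim: "filterlim D at_top sequentially" unfolding D_def using a by real_asymp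
  define Zm where "Zm = (\<lambda>m. \<Sum>j<m. of_real (D j) powr (- s))"
  define G where "G = (\<lambda>m. S (D m) + of_real pi * (of_real (1 / 2 - frac b) * ((of_real d powr (- s) - of_real (D m) powr (- s)) / s)
       - of_real a * ((of_real d powr (1 - s) - of_real (D m) powr (1 - s)) / (s - 1))
       + (R a b d s / s + (Zm m - of_nat m * of_real (D m) powr (- s)) / s)))"
  have "eventually (\<lambda>m. D m \<ge> d \<and> D m \<ge> 1) sequentially"
    using Dlim by (simp add: filterlim_at_top eventually_conj_iff)
  hence "eventually (\<lambda>m. G m = S d) sequentially"
  proof eventually_elim
    case (elim m)
    have "R a b d s = s * (integral {d..D m} F - integral {D 0..D m} F)"
      using R_eq_integral[of a d "D m" b s] a d elim Dmono[of m] by (simp add: D_def F_def)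
    hence "integral {d..D m} F = R a b d s / s + integral {D 0..D m} F" using nz by (simp add: field_simps)
    also have "integral {D 0..D m} F = (Zm m - of_nat m * of_real (D m) powr (- s)) / s"
      unfolding F_def Zm_def D_def by (rule integral_unique, rule floor_integrand_has_integral[OF a nz(1)])
    finally have F: "integral {d..D m} F = R a b d s / s + (Zm m - of_nat m * of_real (D m) powr (- s)) / s" .
    have "S d - S (D m) = of_real pi * (of_real (1 / 2 - frac b) * ((of_real d powr (- s) - of_real (D m) powr (- s)) / s)
       - of_real a * ((of_real d powr (1 - s) - of_real (D m) powr (1 - s)) / (s - 1)) + integral {d..D m} F)"
      unfolding S_def F_def
      by (rule has_integral_unique[OF series_diff_has_integral sawtooth_integral]) (use a d elim nz in auto)
    thus ?case unfolding F G_def by (metis add.commute diff_add_cancel)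
  qed
  hence G1: "G \<longlonglongrightarrow> S d" by (rule tendsto_eventually)
  have powr_lim: "(\<lambda>m. of_real (D m) powr (- z)) \<longlonglongrightarrow> (0 :: complex)" if "Re z > 0" for z
  proof (rule tendsto_norm_zero_cancel)
    have "(\<lambda>m. D m powr (- Re z)) \<longlonglongrightarrow> 0" using that by (intro tendsto_neg_powr Dlim) auto
    thus "(\<lambda>m. norm (complex_of_real (D m) powr (- z))) \<longlonglongrightarrow> 0"
      using D0 by (simp add: norm_powr_real_powr less_imp_le)
  qed
  have l1: "(\<lambda>m. of_real (D m) powr (- s)) \<longlonglongrightarrow> (0 :: complex)" by (rule powr_lim) (use s in auto)
  have l2: "(\<lambda>m. of_real (D m) powr (1 - s)) \<longlonglongrightarrow> (0 :: complex)" using powr_lim[of "s - 1"] s by simp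
  have l3: "(\<lambda>m. of_nat m * of_real (D m) powr (- s)) \<longlonglongrightarrow> (0 :: complex)"
  proof (rule Lim_null_comparison)
    have "norm (of_nat m * complex_of_real (D m) powr (- s)) \<le> a * norm (complex_of_real (D m) powr (1 - s))" for m
    proof -
      have "real m \<le> a * D m" using a fb by (simp add: D_def)
      hence "real m * norm (complex_of_real (D m) powr (- s)) \<le> (a * D m) * norm (complex_of_real (D m) powr (- s))"
        by (intro mult_right_mono) auto
      also have "D m * norm (complex_of_real (D m) powr (- s)) = norm (complex_of_real (D m) powr (1 - s))"
        using D0[of m] by (simp add: powr_diff powr_minus_divide norm_divide)
      hence "(a * D m) * norm (complex_of_real (D m) powr (- s)) = a * norm (complex_of_real (D m) powr (1 - s))"
        by (simp only: mult.assoc)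
      finally show ?thesis by (simp add: norm_mult)
    qed
    thus "\<forall>\<^sub>F m in sequentially. norm (of_nat m * complex_of_real (D m) powr (- s)) \<le> a * norm (complex_of_real (D m) powr (1 - s))"
      by simp
    show "(\<lambda>m. a * norm (complex_of_real (D m) powr (1 - s))) \<longlonglongrightarrow> 0"
      using tendsto_mult_right_zero[OF tendsto_norm_zero[OF l2]] .
  qed
  have l4: "(\<lambda>m. S (D m)) \<longlonglongrightarrow> 0" unfolding S_def
    by (rule filterlim_compose[OF series_tendsto_0 Dlim]) (use a s in auto)
  have l5: "Zm \<longlonglongrightarrow> of_real a powr s * hurwitz_zeta s (1 - frac b)"
  proof -
    have "of_real (D j) powr (- s) = of_real a powr s * of_real (real j + (1 - frac b)) powr (- s)" for j
    proof -
      have "D j * a = real j + (1 - frac b)" using a by (simp add: D_def)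
      hence "complex_of_real (D j) * of_real a = of_real (real j + (1 - frac b))"
        by (simp only: of_real_mult[symmetric])
      hence "of_real (real j + (1 - frac b)) powr (- s) = complex_of_real (D j) powr (- s) * of_real a powr (- s)"
        using D0[of j] a by (metis powr_times_real Reals_of_real Re_complex_of_real less_imp_le)
      thus ?thesis using a by (simp add: powr_minus)
    qed
    moreover have "(\<lambda>j. of_real a powr s * of_real (real j + (1 - frac b)) powr (- s)) sums (of_real a powr s * hurwitz_zeta s (1 - frac b))"
      by (intro sums_mult hurwitz_zeta_sums s) (use fb in simp)
    ultimately show ?thesis unfolding Zm_def sums_def by simp
  qed
  have "G \<longlonglongrightarrow> 0 + of_real pi * (of_real (1 / 2 - frac b) * ((of_real d powr (- s) - 0) / s)
       - of_real a * ((of_real d powr (1 - s) - 0) / (s - 1))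
       + (R a b d s / s + (of_real a powr s * hurwitz_zeta s (1 - frac b) - 0) / s))"
    unfolding G_def by (intro tendsto_intros l1 l2 l3 l4 l5) (use nz in auto)
  from LIMSEQ_unique[OF G1 this] have "S d = of_real pi * (of_real (1 / 2 - frac b) * (of_real d powr (- s) / s)
       - of_real a * (of_real d powr (1 - s) / (s - 1))
       + (R a b d s / s + of_real a powr s * hurwitz_zeta s (1 - frac b) / s))" by simp
  also have "of_real d powr (1 - s) = of_real d * of_real d powr (- s)"
    using d by (simp add: powr_diff powr_minus_divide)
  also have "of_real pi * (of_real (1 / 2 - frac b) * (of_real d powr (- s) / s)
       - of_real a * (of_real d * of_real d powr (- s) / (s - 1))
       + (R a b d s / s + of_real a powr s * hurwitz_zeta s (1 - frac b) / s)) =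
     of_real pi / s * (of_real a powr s * hurwitz_zeta s (1 - frac b)
               - (of_real a * of_real d * s / (s - 1) + of_real (frac b) - 1 / 2) * of_real d powr (- s)
               + R a b d s)"
  proof -
    define Y where "Y = of_real a * of_real d * s / (s - 1)"
    have e1: "of_real a * (of_real d * of_real d powr (- s) / (s - 1)) = Y * of_real d powr (- s) / s"
      using nz by (simp add: Y_def)
    have e2: "p * ((1 / 2 - f) * (x / s) - Y * x / s + (r / s + z / s)) = p / s * (z - (Y + f - 1 / 2) * x + r)"
      for p f x r z :: complex
    proof -
      have "(1 / 2 - f) * (x / s) - Y * x / s + (r / s + z / s) = (z - (Y + f - 1 / 2) * x + r) / s"
        by (simp add: diff_divide_distrib add_divide_distrib ring_distribs)
      thus ?thesis by simp
    qed
    have h: "complex_of_real (1 / 2 - frac b) = 1 / 2 - of_real (frac b)" by simp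
    show ?thesis unfolding h e1 e2 unfolding Y_def ..
  qed
  finally have "S d = \<dots>" .
  thus ?thesis using summable_sums[OF summable_series_term[of a d b s]] a d unfolding S_def by simp
qed

lemma series_term_sums_neg:
  assumes a: "a < 0" and d: "d > 0" and s: "Re s > 1"
  shows "(\<lambda>k. series_term a b d (Suc k) s) sums
     (of_real pi / s * (- (of_real (- a) powr s) * hurwitz_zeta s (1 - frac (- b))
               + (of_real a * of_real d * s / (1 - s) + of_real (frac (- b)) - 1 / 2) * of_real d powr (- s)
               - R (- a) (- b) d s))"
proof -
  have "(\<lambda>k. - series_term (- a) (- b) d (Suc k) s) sums
     - (of_real pi / s * (of_real (- a) powr s * hurwitz_zeta s (1 - frac (- b))
               - (of_real (- a) * of_real d * s / (s - 1) + of_real (frac (- b)) - 1 / 2) * of_real d powr (- s)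
               + R (- a) (- b) d s))"
    by (rule sums_minus, rule series_term_sums_pos) (use assms in auto)
  moreover have "of_real (- a) * of_real d * s / (s - 1) = of_real a * of_real d * s / (1 - s)"
    using minus_divide_divide[of "of_real a * of_real d * s" "1 - s"] by simp
  moreover have "- (P * (A * h - (Q + f - 1 / 2) * x + r)) = P * (- A * h + (Q + f - 1 / 2) * x - r)"
    for P A h Q f x r :: complex by (simp add: algebra_simps)
  moreover have "(\<lambda>k. - series_term (- a) (- b) d (Suc k) s) = (\<lambda>k. series_term a b d (Suc k) s)"
    using assms by (simp add: series_term_uminus)
  ultimately show ?thesis by (simp only:)
qed

section \<open>The series over the unit interval\<close>

lemma powr_has_integral_from_0:
  assumes "Re c > -1"
  shows "((\<lambda>x. complex_of_real x powr c) has_integral 1 / (c + 1)) {0..1}"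
proof -
  have nz: "c + 1 \<noteq> 0" using assms by (auto simp: complex_eq_iff)
  have "((\<lambda>x. complex_of_real x powr c) has_integral (of_real 1 powr (c + 1) / (c + 1) - of_real 0 powr (c + 1) / (c + 1))) {0..1}"
  proof (rule fundamental_theorem_of_calculus_interior)
    show "continuous_on {0..1} (\<lambda>x. complex_of_real x powr (c + 1) / (c + 1))"
      using assms nz by (intro continuous_intros) auto
    fix x :: real assume x: "x \<in> {0<..<1}"
    have "((\<lambda>z. z powr (c + 1) / (c + 1)) has_field_derivative (of_real x powr c)) (at (of_real x))"
      using x nz by (auto intro!: derivative_eq_intros)
    thus "((\<lambda>x. complex_of_real x powr (c + 1) / (c + 1)) has_vector_derivative complex_of_real x powr c) (at x)"
      by (rule has_vector_derivative_real_field)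
  qed auto
  thus ?thesis by simp
qed

text \<open>Subtracting the value of the exponential at \<open>0\<close> removes the pole \<open>1 / s\<close> of the series and extends the
  formula from \<open>Re s < 0\<close> to \<open>Re s < 1\<close>. The primitive is continuous at \<open>0\<close> since it is
  \<open>x powr (1 - s)\<close> times a difference quotient of \<open>lower_gamma_ser\<close>.\<close>

lemma regularized_lower_gamma_has_integral:
  assumes s: "s \<notin> \<nat>" "Re s < 1"
  shows "((\<lambda>x. of_real x powr (- s - 1) * (exp (- (p * of_real x)) - 1)) has_integral
            (lower_gamma_ser (- s) p + 1 / s)) {0..1}"
proof -
  define F where "F = (\<lambda>x. complex_of_real x powr (- s) * lower_gamma_ser (- s) (p * of_real x) + complex_of_real x powr (- s) / s)"
  have ns: "- s \<notin> \<int>\<^sub>\<le>\<^sub>0" using s by (simp add: uminus_notin_nonpos_Ints_iff)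
  have s0: "s \<noteq> 0" using s by auto
  have der: "(F has_vector_derivative of_real x powr (- s - 1) * (exp (- (p * of_real x)) - 1)) (at x within S)"
    if "x > 0" for x S
  proof -
    have "((\<lambda>z. z powr (- s) / s) has_field_derivative (- (of_real x powr (- s - 1)))) (at (of_real x))"
      using that s0 by (auto intro!: derivative_eq_intros)
    hence "((\<lambda>x. complex_of_real x powr (- s) / s) has_vector_derivative - (of_real x powr (- s - 1))) (at x within S)"
      by (rule has_vector_derivative_real_field)
    from has_vector_derivative_add[OF lower_inc_gamma_has_vector_derivative[OF ns that, of p] this]
    show ?thesis unfolding F_def by (simp add: algebra_simps)
  qed
  have L0: "lower_gamma_ser (- s) 0 = - 1 / s" using lower_gamma_ser_0[OF ns] by simp
  have "(F \<longlongrightarrow> F 0) (at 0 within {0..1})"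
  proof -
    define q where "q = (\<lambda>z. (lower_gamma_ser (- s) (p * z) - lower_gamma_ser (- s) (p * 0)) / (z - 0))"
    have "((\<lambda>z. lower_gamma_ser (- s) (p * z)) has_field_derivative (- lower_gamma_ser (- s + 1) (p * 0) * p)) (at 0)"
      by (rule DERIV_chain'[OF DERIV_cmult_Id lower_gamma_ser_has_field_derivative[OF ns]])
    hence "q \<midarrow>0\<rightarrow> - lower_gamma_ser (- s + 1) (p * 0) * p"
      unfolding q_def has_field_derivative_iff .
    moreover have "filterlim complex_of_real (at 0) (at 0 within {0..1})"
    proof (rule filterlim_atI)
      show "(complex_of_real \<longlongrightarrow> 0) (at 0 within {0..1})"
        using tendsto_of_real[OF tendsto_ident_at[of 0 "{0..1::real}"]] by simp
      show "\<forall>\<^sub>F x in at 0 within {0..1}. complex_of_real x \<noteq> 0"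
        using eventually_neq_at_within[of 0 0 "{0..1::real}"] by simp
    qed
    ultimately have q: "((\<lambda>x. q (of_real x)) \<longlongrightarrow> - lower_gamma_ser (- s + 1) (p * 0) * p) (at 0 within {0..1})"
      by (rule filterlim_compose)
    have "continuous_on {0..1} (\<lambda>x. complex_of_real x powr (1 - s))"
      using s by (intro continuous_intros) auto
    hence "\<forall>x\<in>{0..1}. ((\<lambda>x. complex_of_real x powr (1 - s)) \<longlongrightarrow> complex_of_real x powr (1 - s)) (at x within {0..1})"
      unfolding continuous_on_def .
    hence "((\<lambda>x. complex_of_real x powr (1 - s)) \<longlongrightarrow> complex_of_real 0 powr (1 - s)) (at 0 within {0..1})"
      by (rule bspec) simp
    from tendsto_mult[OF this q] have "((\<lambda>x. complex_of_real x powr (1 - s) * q (of_real x)) \<longlongrightarrow> 0) (at 0 within {0..1})"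
      by simp
    moreover have "\<forall>\<^sub>F x in at 0 within {0..1}. complex_of_real x powr (1 - s) * q (of_real x) = F x"
      unfolding eventually_at_filter
    proof (intro always_eventually allI impI)
      fix x :: real assume "x \<noteq> 0" "x \<in> {0..1}"
      thus "complex_of_real x powr (1 - s) * q (of_real x) = F x"
        by (simp add: q_def F_def L0 powr_diff powr_minus_divide field_simps)
    qed
    ultimately have "(F \<longlongrightarrow> 0) (at 0 within {0..1})" by (rule Lim_transform_eventually)
    thus ?thesis by (simp add: F_def)
  qed
  moreover have "(F \<longlongrightarrow> F x) (at x within {0..1})" if "x > 0" for x
    using has_vector_derivative_continuous[OF der[OF that]] by (simp add: continuous_within)
  ultimately have cont: "continuous_on {0..1} F"
    unfolding continuous_on_def by (metis atLeastAtMost_iff less_eq_real_def)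
  have "((\<lambda>x. of_real x powr (- s - 1) * (exp (- (p * of_real x)) - 1)) has_integral (F 1 - F 0)) {0..1}"
    using cont der by (intro fundamental_theorem_of_calculus_interior) auto
  thus ?thesis by (simp add: F_def)
qed

text \<open>The \<open>k\<close>-th term of the second series. It is \<open>1 / k\<close> times the integral over \<open>(0, 1)\<close>, in the sense of
  analytic continuation, of \<open>sin (2 * pi * k * (a * x + b)) * x powr (- s - 1)\<close>.\<close>

definition lower_term :: "real \<Rightarrow> real \<Rightarrow> nat \<Rightarrow> complex \<Rightarrow> complex" where
  "lower_term a b k s =
     2 * of_real pi * of_real a * of_real (cos (2 * pi * b * real k)) / (1 - s) *
       hypergeom_1F2 ((1 - s) / 2) (3 / 2) (1 + (1 - s) / 2) (of_real (- (pi\<^sup>2 * a\<^sup>2 * (real k)\<^sup>2)))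
     - of_real (sin (2 * pi * b * real k)) / (s * of_nat k) *
       hypergeom_1F2 (- s / 2) (1 / 2) (1 - s / 2) (of_real (- (pi\<^sup>2 * a\<^sup>2 * (real k)\<^sup>2)))"

lemma lower_term_has_integral:
  assumes s: "s \<notin> \<nat>" "Re s < 1" and k: "k > 0"
  shows "((\<lambda>x. of_real ((sin (2 * pi * real k * (a * x + b)) - sin (2 * pi * real k * b)) / real k) * of_real x powr (- s - 1))
           has_integral (lower_term a b k s + of_real (sin (2 * pi * real k * b) / real k) / s)) {0..1}"
proof -
  let ?y = "2 * pi * real k * a" and ?t = "2 * pi * real k * b"
  define e where "e = exp (\<i> * complex_of_real ?t)"
  define e' where "e' = exp (- (\<i> * complex_of_real ?t))"
  define c where "c = 1 / (2 * \<i> * (of_nat k :: complex))"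
  define H1 where "H1 = hypergeom_1F2 (- s / 2) (1 / 2) (1 - s / 2) (of_real (- (pi\<^sup>2 * a\<^sup>2 * (real k)\<^sup>2)))"
  define H2 where "H2 = hypergeom_1F2 ((1 - s) / 2) (3 / 2) (1 + (1 - s) / 2) (of_real (- (pi\<^sup>2 * a\<^sup>2 * (real k)\<^sup>2)))"
  define Y where "Y = of_real ?y / (1 - s) * H2"
  define sn where "sn = complex_of_real (sin ?t)"
  define cs where "cs = complex_of_real (cos ?t)"
  have y: "(?y / 2) ^ 2 = pi\<^sup>2 * a\<^sup>2 * (real k)\<^sup>2" "(- ?y / 2) ^ 2 = pi\<^sup>2 * a\<^sup>2 * (real k)\<^sup>2"
    by (simp_all add: power2_eq_square)
  have L1: "lower_gamma_ser (- s) (- \<i> * of_real ?y) = \<i> * Y - H1 / s"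
    using lower_gamma_ser_imaginary_conv_1F2[OF s(1), of ?y] unfolding y H1_def H2_def Y_def by simp
  have L2: "lower_gamma_ser (- s) (- \<i> * of_real (- ?y)) = - (\<i> * Y) - H1 / s"
    using lower_gamma_ser_imaginary_conv_1F2[OF s(1), of "- ?y"] unfolding y H1_def H2_def Y_def by simp
  have k0: "(of_nat k :: complex) \<noteq> 0" using k by simp
  have Euler: "exp (\<i> * of_real t) = of_real (cos t) + \<i> * of_real (sin t)" for t
    by (simp add: exp_Euler cos_of_real sin_of_real)
  have e1: "e = cs + \<i> * sn" unfolding e_def cs_def sn_def Euler ..
  have e2: "e' = cs - \<i> * sn"
    using Euler[of "- ?t"] unfolding e'_def cs_def sn_def by simp
  have "((\<lambda>x. c * (e * (of_real x powr (- s - 1) * (exp (- (- \<i> * of_real ?y * of_real x)) - 1)) -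
        e' * (of_real x powr (- s - 1) * (exp (- (- \<i> * of_real (- ?y) * of_real x)) - 1)))) has_integral
      c * (e * (lower_gamma_ser (- s) (- \<i> * of_real ?y) + 1 / s) - e' * (lower_gamma_ser (- s) (- \<i> * of_real (- ?y)) + 1 / s))) {0..1}"
    by (intro has_integral_mult_right has_integral_diff regularized_lower_gamma_has_integral s)
  also have "c * (e * (lower_gamma_ser (- s) (- \<i> * of_real ?y) + 1 / s) - e' * (lower_gamma_ser (- s) (- \<i> * of_real (- ?y)) + 1 / s))
      = c * (2 * \<i> * (cs * Y - sn * (H1 / s) + sn * (1 / s)))"
    unfolding L1 L2 e1 e2 by (simp add: algebra_simps)
  also have "\<dots> = cs * Y / of_nat k - sn * (H1 / s) / of_nat k + sn * (1 / s) / of_nat k"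
    using k0 by (simp add: c_def diff_divide_distrib add_divide_distrib)
  also have "\<dots> = lower_term a b k s + of_real (sin ?t / real k) / s"
  proof -
    have "2 * pi * b * real k = ?t" by simp
    thus ?thesis unfolding lower_term_def H1_def[symmetric] H2_def[symmetric] cs_def[symmetric] sn_def[symmetric] of_real_divide
      using k0 by (simp only: cs_def[symmetric] sn_def[symmetric]) (simp add: Y_def mult_ac)
  qed
  also have "(\<lambda>x. c * (e * (of_real x powr (- s - 1) * (exp (- (- \<i> * of_real ?y * of_real x)) - 1)) -
        e' * (of_real x powr (- s - 1) * (exp (- (- \<i> * of_real (- ?y) * of_real x)) - 1))))
     = (\<lambda>x. of_real ((sin (2 * pi * real k * (a * x + b)) - sin ?t) / real k) * of_real x powr (- s - 1))"
  proof
    fix x :: real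
    let ?u = "2 * pi * real k * (a * x + b)"
    define X where "X = complex_of_real x powr (- s - 1)"
    have gen: "c * (e * (X * (P - 1)) - e' * (X * (Q - 1))) = c * X * ((e * P - e' * Q) - (e - e'))" for P Q
      by (simp add: algebra_simps)
    have m1: "e * exp (- (- \<i> * of_real ?y * of_real x)) = exp (\<i> * of_real ?u)"
      unfolding e_def mult_exp_exp by (rule arg_cong[of _ _ exp]) (simp add: algebra_simps)
    have m2: "e' * exp (- (- \<i> * of_real (- ?y) * of_real x)) = exp (- (\<i> * of_real ?u))"
      unfolding e'_def mult_exp_exp by (rule arg_cong[of _ _ exp]) (simp add: algebra_simps)
    have sinexp: "exp (\<i> * of_real t) - exp (- (\<i> * of_real t)) = 2 * \<i> * of_real (sin t)" for t
      unfolding sin_of_real[symmetric] sin_exp_eq by simp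
    have "c * (e * (X * (exp (- (- \<i> * of_real ?y * of_real x)) - 1)) - e' * (X * (exp (- (- \<i> * of_real (- ?y) * of_real x)) - 1)))
      = c * X * ((e * exp (- (- \<i> * of_real ?y * of_real x)) - e' * exp (- (- \<i> * of_real (- ?y) * of_real x))) - (e - e'))"
      by (rule gen)
    also have "\<dots> = c * X * (2 * \<i> * of_real (sin ?u) - 2 * \<i> * of_real (sin ?t))"
      unfolding m1 m2 sinexp unfolding e_def e'_def sinexp ..
    also have "\<dots> = of_real ((sin ?u - sin ?t) / real k) * X"
      using k0 by (simp add: c_def field_simps)
    finally show "c * (e * (of_real x powr (- s - 1) * (exp (- (- \<i> * of_real ?y * of_real x)) - 1)) -
        e' * (of_real x powr (- s - 1) * (exp (- (- \<i> * of_real (- ?y) * of_real x)) - 1)))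
      = of_real ((sin ?u - sin ?t) / real k) * of_real x powr (- s - 1)" unfolding X_def .
  qed
  finally show ?thesis .
qed

lemma norm_powr_real_nonneg: "x \<ge> 0 \<Longrightarrow> norm (complex_of_real x powr z) = x powr Re z"
  by (simp add: norm_powr_real_powr)

text \<open>The two alternatives for \<open>s\<close> and \<open>b\<close> call for different majorants: the Lipschitz bound gains one power of \<open>x\<close>, and for integer \<open>b\<close> the
  subtracted value is \<open>0\<close>.\<close>

lemma lower_dominating_function:
  assumes "a \<noteq> 0" and s: "(Re s < 1 \<and> b \<notin> \<int>) \<or> (Re s < 0 \<and> b \<in> \<int>)"
  obtains h where "h integrable_on {0..1}"
    "\<And>N x. x \<in> {0..1} \<Longrightarrow> norm (of_real (sawtooth_sum N (a * x + b) - sawtooth_sum N b) * complex_of_real x powr (- s - 1)) \<le> h x"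
  using s
proof (elim disjE conjE)
  assume *: "Re s < 1" "b \<notin> \<int>"
  obtain L where L: "L \<ge> 0" "\<And>N u. \<bar>sawtooth_sum N (b + u) - sawtooth_sum N b\<bar> \<le> L * \<bar>u\<bar>"
    using sawtooth_sum_lipschitz[OF *(2)] by blast
  show ?thesis
  proof (rule that[of "\<lambda>x. L * \<bar>a\<bar> * x powr (- Re s)"])
    show "(\<lambda>x. L * \<bar>a\<bar> * x powr - Re s) integrable_on {0..1}"
      using * by (intro integrable_on_mult_right integrable_on_powr_from_0) auto
    fix N and x :: real assume x: "x \<in> {0..1}"
    have "\<bar>sawtooth_sum N (a * x + b) - sawtooth_sum N b\<bar> \<le> L * \<bar>a\<bar> * x"
      using L(2)[of N "a * x"] x by (simp add: abs_mult add.commute)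
    hence "norm (of_real (sawtooth_sum N (a * x + b) - sawtooth_sum N b) * complex_of_real x powr (- s - 1))
        \<le> L * \<bar>a\<bar> * x * x powr (- Re s - 1)"
      using x unfolding norm_mult norm_of_real by (intro mult_mono) (auto simp: norm_powr_real_nonneg)
    also have "\<dots> = L * \<bar>a\<bar> * x powr (- Re s)"
      using x by (cases "x = 0") (auto simp: powr_diff)
    finally show "norm (of_real (sawtooth_sum N (a * x + b) - sawtooth_sum N b) * complex_of_real x powr (- s - 1)) \<le> L * \<bar>a\<bar> * x powr (- Re s)" .
  qed
next
  assume *: "Re s < 0" "b \<in> \<int>"
  show ?thesis
  proof (rule that[of "\<lambda>x. 4 * x powr (- Re s - 1)"])
    show "(\<lambda>x. 4 * x powr (- Re s - 1)) integrable_on {0..1}"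
      using * by (intro integrable_on_mult_right integrable_on_powr_from_0) auto
    fix N and x :: real assume x: "x \<in> {0..1}"
    have "\<bar>sawtooth_sum N (a * x + b) - sawtooth_sum N b\<bar> \<le> 4"
      using abs_sawtooth_sum_le[of N "a * x + b"] sawtooth_sum_Int[OF *(2), of N] by simp
    thus "norm (of_real (sawtooth_sum N (a * x + b) - sawtooth_sum N b) * complex_of_real x powr (- s - 1)) \<le> 4 * x powr (- Re s - 1)"
      using x unfolding norm_mult norm_of_real by (intro mult_mono) (auto simp: norm_powr_real_nonneg)
  qed
qed

text \<open>The integer part vanishes near \<open>x = 0\<close>, because \<open>frac b\<close> lies strictly between \<open>0\<close> and \<open>1\<close>. Where it does
  not vanish, \<open>\<bar>a * x\<bar> \<ge> m\<close>, and this lower bound absorbs the constant \<open>1\<close>.\<close>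

lemma abs_floor_le_linear:
  assumes "b \<notin> \<int>"
  obtains K where "K \<ge> 0" "\<And>x. x > 0 \<Longrightarrow> \<bar>real_of_int \<lfloor>a * x + frac b\<rfloor>\<bar> \<le> K * x"
proof -
  define m where "m = min (frac b) (1 - frac b)"
  have m: "m > 0" "m \<le> frac b" "m \<le> 1 - frac b"
    using assms frac_lt_1[of b] frac_ge_0[of b] frac_gt_0_iff[of b] by (auto simp: m_def)
  show ?thesis
  proof (rule that[of "\<bar>a\<bar> + \<bar>a\<bar> / m"])
    show "\<bar>a\<bar> + \<bar>a\<bar> / m \<ge> 0" using m by simp
    fix x :: real assume x: "x > 0"
    have ax: "\<bar>a * x\<bar> = \<bar>a\<bar> * x" using x by (simp add: abs_mult)
    show "\<bar>real_of_int \<lfloor>a * x + frac b\<rfloor>\<bar> \<le> (\<bar>a\<bar> + \<bar>a\<bar> / m) * x"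
    proof (cases "\<lfloor>a * x + frac b\<rfloor> = 0")
      case False
      have "\<bar>a * x\<bar> \<ge> m"
      proof (rule ccontr)
        assume "\<not> ?thesis"
        hence "0 \<le> a * x + frac b" "a * x + frac b < 1" using m by linarith+
        hence "\<lfloor>a * x + frac b\<rfloor> = 0" by (simp add: floor_eq_iff)
        with False show False by simp
      qed
      hence "1 \<le> \<bar>a\<bar> / m * x" using m ax by (simp add: field_simps)
      moreover have "\<bar>real_of_int \<lfloor>a * x + frac b\<rfloor>\<bar> \<le> \<bar>a * x\<bar> + 1"
        using frac_lt_1[of b] frac_ge_0[of b] by linarith
      ultimately show ?thesis using ax by (simp add: ring_distribs)
    qed (use x m in auto)
  qed
qed

lemma floor_integrand_integrable_0_1:
  assumes s: "(Re s < 1 \<and> b \<notin> \<int>) \<or> (Re s < 0 \<and> b \<in> \<int>)"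
  shows "set_integrable lborel {0<..<1} (floor_integrand a b s)"
proof -
  obtain K \<tau> where K: "\<tau> > -1" "\<And>x. x \<in> {0<..<1} \<Longrightarrow> norm (floor_integrand a b s x) \<le> K * x powr \<tau>"
    using s
  proof (elim disjE conjE)
    assume *: "Re s < 1" "b \<notin> \<int>"
    obtain K where K: "K \<ge> 0" "\<And>x. x > 0 \<Longrightarrow> \<bar>real_of_int \<lfloor>a * x + frac b\<rfloor>\<bar> \<le> K * x"
      using abs_floor_le_linear[OF *(2)] by blast
    show ?thesis
    proof (rule that[of "- Re s" K])
      fix x :: real assume x: "x \<in> {0<..<1}"
      have "norm (floor_integrand a b s x) \<le> K * x * x powr (- Re s - 1)"
        unfolding norm_mult norm_of_int using x K by (intro mult_mono) (auto simp: norm_powr_real_nonneg)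
      also have "\<dots> = K * x powr (- Re s)" using x by (simp add: powr_diff)
      finally show "norm (floor_integrand a b s x) \<le> K * x powr (- Re s)" .
    qed (use * in auto)
  next
    assume *: "Re s < 0" "b \<in> \<int>"
    show ?thesis
    proof (rule that[of "- Re s - 1" "\<bar>a\<bar> + 2"])
      fix x :: real assume x: "x \<in> {0<..<1}"
      have "\<bar>a * x\<bar> \<le> \<bar>a\<bar> * 1" unfolding abs_mult using x by (intro mult_left_mono) auto
      hence "\<bar>real_of_int \<lfloor>a * x + frac b\<rfloor>\<bar> \<le> \<bar>a\<bar> + 2"
        using frac_lt_1[of b] frac_ge_0[of b] by linarith
      thus "norm (floor_integrand a b s x) \<le> (\<bar>a\<bar> + 2) * x powr (- Re s - 1)"
        unfolding norm_mult norm_of_int using x by (intro mult_mono) (auto simp: norm_powr_real_nonneg)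
    qed (use * in auto)
  qed
  have eq: "(\<lambda>x. indicator {0<..<1} x *\<^sub>R floor_integrand a b s x) =
        (\<lambda>x. indicator {0<..<1} x *\<^sub>R (indicator {0<..} x *\<^sub>R floor_integrand a b s x))"
    by (auto simp: fun_eq_iff indicator_def)
  have [measurable]: "(\<lambda>x. indicator {0<..} x *\<^sub>R floor_integrand a b s x) \<in> borel_measurable borel"
    by (rule floor_integrand_measurable)
  have meas: "(\<lambda>x. indicator {0<..<1} x *\<^sub>R floor_integrand a b s x) \<in> borel_measurable borel"
    unfolding eq by measurable
  have "(\<lambda>x. K * x powr \<tau>) integrable_on {0..1}"
    using K(1) by (intro integrable_on_mult_right integrable_on_powr_from_0) auto
  hence int: "(\<lambda>x. K * x powr \<tau>) integrable_on {0<..<1}"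
    by (simp add: integrable_on_Icc_iff_Ioo)
  have "floor_integrand a b s \<in> borel_measurable (lebesgue_on {0<..<1})"
    using meas by (subst borel_measurable_restrict_space_iff) (auto intro: measurable_completion)
  from measurable_bounded_by_integrable_imp_absolutely_integrable[OF this _ int K(2)]
  have "set_integrable lebesgue {0<..<1} (floor_integrand a b s)" by simp
  thus ?thesis unfolding set_integrable_def using meas by (simp add: integrable_completion)
qed

lemma floor_integrand_has_integral_0_1:
  assumes "(Re s < 1 \<and> b \<notin> \<int>) \<or> (Re s < 0 \<and> b \<in> \<int>)"
  shows "(floor_integrand a b s has_integral (LINT x:{0<..<1}|lborel. floor_integrand a b s x)) {0..1}"
proof -
  have "(floor_integrand a b s has_integral (LINT x:{0<..<1}|lborel. floor_integrand a b s x)) {0<..<1}"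
    using set_borel_integral_eq_integral[OF floor_integrand_integrable_0_1[OF assms, of a]]
    by (simp add: has_integral_iff)
  thus ?thesis by (simp only: has_integral_Icc_iff_Ioo)
qed

text \<open>Between \<open>0\<close> and \<open>(1 - frac b) / a\<close> the integer part vanishes, whatever the sign of \<open>a\<close>. So the
  integral from \<open>1\<close> to that point may as well run from \<open>1\<close> to \<open>0\<close>.\<close>

lemma R_1_eq_integral:
  assumes a: "a \<noteq> 0"
  shows "R a b 1 s = - s * (LINT x:{0<..<1}|lborel. floor_integrand a b s x)"
proof -
  define u where "u = (1 - frac b) / a"
  have fb: "0 \<le> frac b" "frac b < 1" using frac_ge_0 frac_lt_1 by auto
  let ?f = "floor_integrand a b s"
  define J where "J = (LINT x:{0<..<1}|lborel. ?f x)"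
  have e: "(CLBINT x=ereal p..ereal q. ?f x) = (LINT x:{p<..<q}|lborel. ?f x)" if "p \<le> q" for p q
  proof -
    have "einterval (ereal p) (ereal q) = {p<..<q}" by (auto simp: einterval_def)
    thus ?thesis using interval_lebesgue_integral_le_eq[of "ereal p" "ereal q" lborel ?f] that by simp
  qed
  have "(CLBINT x=ereal 1..ereal u. ?f x) = - J"
  proof -
    consider "a < 0" | "a > 0" "u < 1" | "a > 0" "u \<ge> 1" using a by linarith
    thus ?thesis
    proof cases
      case 1
      have u: "u < 0" using 1 fb by (simp add: u_def divide_pos_neg)
      have z: "\<lfloor>a * x + frac b\<rfloor> = 0" if "u < x" "x \<le> 0" for x
      proof -
        have "a * x \<ge> 0" using 1 that by (simp add: mult_nonpos_nonpos)
        moreover have "a * x < 1 - frac b" using 1 that by (simp add: u_def field_simps)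
        ultimately show ?thesis using fb by (simp add: floor_eq_iff)
      qed
      have "(CLBINT x=ereal u..ereal 1. ?f x) = (LINT x:{u<..<1}|lborel. ?f x)"
        using u by (intro e) simp 
      also have "\<dots> = J" unfolding J_def set_lebesgue_integral_def
        by (rule Bochner_Integration.integral_cong) (use u z in \<open>auto simp: indicator_def\<close>)
      finally show ?thesis by (subst interval_integral_endpoints_reverse) simp
    next
      case 2
      have u: "u > 0" using 2 fb by (simp add: u_def)
      have z: "\<lfloor>a * x + frac b\<rfloor> = 0" if "0 < x" "x < u" for x
      proof -
        have "a * x \<ge> 0" using 2 that by simp
        moreover have "a * x < 1 - frac b" using 2 that by (simp add: u_def field_simps)
        ultimately show ?thesis using fb by (simp add: floor_eq_iff)
      qed
      have "(CLBINT x=ereal u..ereal 1. ?f x) = (LINT x:{u<..<1}|lborel. ?f x)"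
        using 2 by (intro e) simp
      also have "\<dots> = J" unfolding J_def set_lebesgue_integral_def
      proof (rule integral_discrete_difference[where X = "{u}"])
        fix x :: real assume "x \<notin> {u}"
        thus "indicator {u<..<1} x *\<^sub>R ?f x = indicator {0<..<1} x *\<^sub>R ?f x"
          using z[of x] u by (cases "x < u") (auto simp: indicator_def)
      qed auto
      finally show ?thesis by (subst interval_integral_endpoints_reverse) simp
    next
      case 3
      have z: "\<lfloor>a * x + frac b\<rfloor> = 0" if "0 < x" "x < u" for x
      proof -
        have "a * x \<ge> 0" using 3 that by simp
        moreover have "a * x < 1 - frac b" using 3 that by (simp add: u_def field_simps)
        ultimately show ?thesis using fb by (simp add: floor_eq_iff)
      qed
      have "(CLBINT x=ereal 1..ereal u. ?f x) = (LINT x:{1<..<u}|lborel. ?f x)"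
        using 3 by (intro e) simp
      also have "\<dots> = 0" unfolding set_lebesgue_integral_def
        by (rule integral_eq_zero_AE, rule AE_I2) (use z in \<open>auto simp: indicator_def\<close>)
      also have "J = 0" unfolding J_def set_lebesgue_integral_def
        by (rule integral_eq_zero_AE, rule AE_I2) (use 3 z in \<open>auto simp: indicator_def\<close>)
      hence "0 = - J" by simp
      finally show ?thesis .
    qed
  qed
  moreover have "(CLBINT x=ereal 1..ereal 1. ?f x) = 0" by simp
  ultimately show ?thesis unfolding R_def u_def[symmetric] J_def[symmetric] by simp
qed

text \<open>The constant \<open>\<kappa>\<close> is the difference between \<open>pi * (1 / 2 - frac b)\<close> and the value of the Fourier series at \<open>b\<close>.
  It is \<open>0\<close> unless \<open>b\<close> is an integer, and in that case \<open>x powr (- s - 1)\<close> is integrable by itself.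
  In the sum \<open>\<kappa>\<close> cancels.\<close>

lemma lower_term_sums:
  assumes a: "a \<noteq> 0" and s0: "s \<noteq> 0" and s: "(Re s < 1 \<and> b \<notin> \<int>) \<or> (Re s < 0 \<and> b \<in> \<int>)"
  shows "(\<lambda>k. lower_term a b (Suc k) s) sums
    (of_real pi / s * (of_real a * s / (s - 1) + of_real (frac b) - 1 / 2 - R a b 1 s))"
proof -
  have Re: "Re s < 1" using s by auto
  have sN: "s \<notin> \<nat>"
  proof
    assume "s \<in> \<nat>"
    then obtain n where "s = of_nat n" by (auto elim: Nats_cases)
    with Re s0 show False by (cases n) auto
  qed
  define f where "f = (\<lambda>N x. of_real (sawtooth_sum N (a * x + b) - sawtooth_sum N b) * complex_of_real x powr (- s - 1))"
  define g where "g = (\<lambda>x. of_real (sawtooth (a * x + b) - sawtooth b) * complex_of_real x powr (- s - 1))"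
  define \<kappa> where "\<kappa> = pi * (1 / 2 - frac b) - sawtooth b"
  define J where "J = (LINT x:{0<..<1}|lborel. floor_integrand a b s x)"
  obtain h where h: "h integrable_on {0..1}" "\<And>N x. x \<in> {0..1} \<Longrightarrow> norm (f N x) \<le> h x"
    using lower_dominating_function[OF a s] unfolding f_def by blast
  have f: "(f N has_integral (\<Sum>k<N. lower_term a b (Suc k) s) + of_real (sawtooth_sum N b) / s) {0..1}" for N
  proof -
    have "((\<lambda>x. \<Sum>k<N. of_real ((sin (2 * pi * real (Suc k) * (a * x + b)) - sin (2 * pi * real (Suc k) * b)) / real (Suc k)) * of_real x powr (- s - 1))
      has_integral (\<Sum>k<N. lower_term a b (Suc k) s + of_real (sin (2 * pi * real (Suc k) * b) / real (Suc k)) / s)) {0..1}"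
      by (intro has_integral_sum lower_term_has_integral sN Re) auto
    moreover have "f N = (\<lambda>x. \<Sum>k<N. of_real ((sin (2 * pi * real (Suc k) * (a * x + b)) - sin (2 * pi * real (Suc k) * b)) / real (Suc k)) * of_real x powr (- s - 1))"
      unfolding f_def sawtooth_sum_def sum_subtractf[symmetric] diff_divide_distrib of_real_sum sum_distrib_right ..
    moreover have "(\<Sum>k<N. lower_term a b (Suc k) s + of_real (sin (2 * pi * real (Suc k) * b) / real (Suc k)) / s) =
       (\<Sum>k<N. lower_term a b (Suc k) s) + of_real (sawtooth_sum N b) / s"
      unfolding sawtooth_sum_def of_real_sum sum_divide_distrib sum.distrib ..
    ultimately show ?thesis by (simp only:)
  qed
  have fi: "f N integrable_on {0..1}" for N using f by blast
  have cv: "(\<lambda>N. f N x) \<longlonglongrightarrow> g x" for x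
    unfolding f_def g_def by (intro tendsto_intros sawtooth_sum_tendsto)
  have "(\<lambda>N. integral {0..1} (f N)) \<longlonglongrightarrow> integral {0..1} g"
    by (rule dominated_convergence(2)[OF fi h cv])
  hence "(\<lambda>N. (\<Sum>k<N. lower_term a b (Suc k) s) + of_real (sawtooth_sum N b) / s) \<longlonglongrightarrow> integral {0..1} g"
    unfolding integral_unique[OF f] .
  hence "(\<lambda>N. (\<Sum>k<N. lower_term a b (Suc k) s) + of_real (sawtooth_sum N b) / s - of_real (sawtooth_sum N b) / s)
     \<longlonglongrightarrow> integral {0..1} g - of_real (sawtooth b) / s"
    by (intro tendsto_intros sawtooth_sum_tendsto) (use s0 in auto)
  hence lim: "(\<lambda>k. lower_term a b (Suc k) s) sums (integral {0..1} g - of_real (sawtooth b) / s)"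
    by (simp add: sums_def)
  have i1: "((\<lambda>x. of_real \<kappa> * of_real x powr (- s - 1)) has_integral of_real \<kappa> * (- 1 / s)) {0..1}"
  proof (cases "b \<in> \<int>")
    case True
    thus ?thesis using powr_has_integral_from_0[of "- s - 1"] s by (intro has_integral_mult_right) auto
  next
    case False
    hence "\<kappa> = 0" by (simp add: \<kappa>_def sawtooth_def)
    thus ?thesis by simp
  qed
  have i2: "((\<lambda>x. of_real x powr (- s)) has_integral 1 / (1 - s)) {0..1}"
    using powr_has_integral_from_0[of "- s"] Re by simp
  have i3: "(floor_integrand a b s has_integral J) {0..1}"
    unfolding J_def by (rule floor_integrand_has_integral_0_1[OF s])
  have i: "((\<lambda>x. of_real \<kappa> * of_real x powr (- s - 1) - of_real (pi * a) * of_real x powr (- s) + of_real pi * floor_integrand a b s x)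
      has_integral of_real \<kappa> * (- 1 / s) - of_real (pi * a) * (1 / (1 - s)) + of_real pi * J) {0..1}"
    by (intro has_integral_add has_integral_diff has_integral_mult_right i1 i2 i3)
  have neg: "negligible {x. a * x + b \<in> \<int>}" using a by (rule negligible_int_preimage)
  have eq: "g x = of_real \<kappa> * of_real x powr (- s - 1) - of_real (pi * a) * of_real x powr (- s) + of_real pi * floor_integrand a b s x"
    if x: "x \<in> {0..1} - {x. a * x + b \<in> \<int>}" for x
  proof -
    have "complex_of_real x powr (- s) = of_real x * of_real x powr (- s - 1)"
      using x by (cases "x = 0") (simp_all add: powr_diff)
    moreover have "sawtooth (a * x + b) = pi * (1 / 2 - frac b - a * x + of_int \<lfloor>a * x + frac b\<rfloor>)"
      using x by (intro sawtooth_affine_notin_Ints) auto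
    hence "sawtooth (a * x + b) - sawtooth b = \<kappa> - pi * a * x + pi * of_int \<lfloor>a * x + frac b\<rfloor>"
      by (simp add: \<kappa>_def algebra_simps)
    ultimately show ?thesis unfolding g_def by (simp add: ring_distribs)
  qed
  have "integral {0..1} g = of_real \<kappa> * (- 1 / s) - of_real (pi * a) * (1 / (1 - s)) + of_real pi * J"
    by (rule integral_unique[OF has_integral_spike[OF neg eq i]])
  hence "integral {0..1} g - of_real (sawtooth b) / s = of_real pi * J - of_real pi * (of_real a / (1 - s)) - (of_real \<kappa> + of_real (sawtooth b)) / s"
    by (simp add: add_divide_distrib)
  also have "complex_of_real \<kappa> + of_real (sawtooth b) = of_real pi * (1 / 2 - of_real (frac b))"
    unfolding \<kappa>_def by simp
  also have "of_real pi * J - of_real pi * (of_real a / (1 - s)) - of_real pi * (1 / 2 - of_real (frac b)) / s =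
      of_real pi / s * (of_real a * s / (s - 1) + of_real (frac b) - 1 / 2 - R a b 1 s)"
  proof -
    have "of_real a * s / (s - 1) = - (of_real a / (1 - s)) * s"
    proof -
      have "of_real a * s / (s - 1) = of_real a * s / (- (1 - s))" by simp
      also have "\<dots> = - (of_real a * s / (1 - s))" by (rule minus_divide_right[symmetric])
      finally show ?thesis by simp
    qed
    moreover have "p * J - p * Q - p * (1 / 2 - F) / s = p / s * (- Q * s + F - 1 / 2 - (- s * J))" for p Q F
      using s0 by (simp add: field_simps)
    ultimately show ?thesis unfolding R_1_eq_integral[OF a] J_def[symmetric] by (simp only:)
  qed
  finally show ?thesis using lim by (simp only:)
qed

theorem theoremt:
  shows
    "(\<forall>(a::real) (b::real) (d::real) (s::complex). a \<noteq> 0 \<longrightarrow> d > 0 \<longrightarrow> Re s > 1 \<longrightarrow>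
        (\<lambda>k. series_term a b d (Suc k) s) sums
          (of_real pi / s *
            (if a > 0 then
               of_real a powr s * hurwitz_zeta s (1 - frac b)
               - (of_real a * of_real d * s / (s - 1) + of_real (frac b) - 1 / 2) * of_real d powr (- s)
               + R a b d s
             else
               - (of_real (- a) powr s) * hurwitz_zeta s (1 - frac (- b))
               + (of_real a * of_real d * s / (1 - s) + of_real (frac (- b)) - 1 / 2) * of_real d powr (- s)
               - R (- a) (- b) d s)))
     \<and>
     (\<forall>(a::real) (b::real) (d::real). a \<noteq> 0 \<longrightarrow> d > 0 \<longrightarrow>
        (\<forall>k\<ge>1. series_term a b d k holomorphic_on UNIV \<and>
                (\<forall>s. s \<notin> \<nat> \<longrightarrow> series_term a b d k s = raw_term a b d k s)) \<and>
        (\<forall>s. summable (\<lambda>k. norm (series_term a b d (Suc k) s))) \<and>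
        (\<lambda>s. \<Sum>k. series_term a b d (Suc k) s) holomorphic_on UNIV)
     \<and>
     (\<forall>(c::real) (C::real) (\<epsilon>::real) (M::real). c > 0 \<longrightarrow> \<epsilon> > 0 \<longrightarrow>
        uniformly_convergent_on (conv_region c C \<epsilon> M)
          (\<lambda>N (a, b, d, s). \<Sum>k<N. norm (series_term a b d (Suc k) s)) \<and>
        uniform_limit (conv_region c C \<epsilon> M)
          (\<lambda>N (a, b, d, s). \<Sum>k<N. series_term a b d (Suc k) s)
          (\<lambda>(a, b, d, s). \<Sum>k. series_term a b d (Suc k) s) sequentially)
     \<and>
     (\<forall>(a::real) (b::real) (s::complex). a \<noteq> 0 \<longrightarrow> s \<noteq> 0 \<longrightarrow>
        (Re s < 1 \<and> b \<notin> \<int>) \<or> (Re s < 0 \<and> b \<in> \<int>) \<longrightarrow>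
        (\<lambda>n. let k = Suc n in
           2 * of_real pi * of_real a * of_real (cos (2 * pi * b * real k)) / (1 - s) *
             hypergeom_1F2 ((1 - s) / 2) (3 / 2) (1 + (1 - s) / 2)
               (of_real (- (pi\<^sup>2 * a\<^sup>2 * (real k)\<^sup>2)))
           - of_real (sin (2 * pi * b * real k)) / (s * of_nat k) *
             hypergeom_1F2 (- s / 2) (1 / 2) (1 - s / 2)
               (of_real (- (pi\<^sup>2 * a\<^sup>2 * (real k)\<^sup>2))))
        sums
          (of_real pi / s *
            (of_real a * s / (s - 1) + of_real (frac b) - 1 / 2 - R a b 1 s)))"
proof (intro conjI allI impI, goal_cases)
  case (1 a b d s)
  thus ?case using series_term_sums_pos[of a d s b] series_term_sums_neg[of a d s b] by (cases "a > 0") auto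
next
  case (2 a b d k)
  thus ?case by (intro holomorphic_on_series_term) auto
next
  case (3 a b d k s)
  thus ?case by (intro series_term_eq_raw_term) auto
next
  case (4 a b d s)
  thus ?case by (intro norm_series_term_summable)
next
  case (5 a b d)
  thus ?case by (intro holomorphic_on_series)
next
  case (6 c C \<epsilon> M)
  thus ?case by (intro conv_region_uniform(1))
next
  case (7 c C \<epsilon> M)
  thus ?case by (intro conv_region_uniform(2))
next
  case (8 a b s)
  thus ?case using lower_term_sums[of a s b] unfolding lower_term_def Let_def by simp
qed

end
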